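(* Let $B$ be a Boolean $\sigma$-algebra. Then $B$ is a measure algebra if and only if $B$ is weakly distributive and uniformly concentrated.
   Context: A Boolean algebra $B$ is an algebra of subsets of a nonempty set $X$ with operations $a\cup b$, $a\cap b$, $-a=X-a$, zero $\mathbf 0=\emptyset$ and unit $\mathbf 1=X$ (so $\mathbf 0\neq\mathbf 1$), ordered by inclusion. $B$ is a Boolean $\sigma$-algebra if every countable $A\subset B$ has a supremum $\bigvee A$ and an infimum $\bigwedge A$ in the ordering of $B$. $B^+=B-\{\mathbf 0\}$. A measure on a Boolean $\sigma$-algebra $B$ is a real-valued function $m$ on $B$ with: $m(\mathbf 0)=0$, $m(a)>0$ for $a\ne\mathbf 0$, $m(\mathbf 1)=1$; $m(a)\le m(b)$ if $a\subset b$; $m(a\cup b)=m(a)+m(b)$ if $a\cap b=\mathbf 0$; and $m(\bigvee_{n=1}^\infty a_n)=\sum_{n=1}^\infty m(a_n)$ whenever the $a_n$ are pairwise disjoint. A measure algebra is a Boolean $\sigma$-algebra that carries a measure. An antichain is a set $A\subset B^+$ such that $a\cap b=\mathbf 0$ for all distinct $a,b\in A$. A partition (of $\mathbf 1$) is a maximal antichain, i.e. an antichain with supremum $\mathbf 1$. $B$ is weakly distributive if for every sequence $\{W_n\}_n$ of partitions there is a partition $W$ such that each $a\in W$ meets (has nonzero intersection with) only finitely many elements of each $W_n$. For a sequence $\{a_n\}_n$ in a Boolean $\sigma$-algebra, $\limsup_n a_n=\bigwedge_{n=1}^\infty\bigvee_{k=n}^\infty a_k$ and $\liminf_n a_n=\bigvee_{n=1}^\infty\bigwedge_{k=n}^\infty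 a_k$; $\lim_n a_n=a$ means $\limsup_n a_n=\liminf_n a_n=a$. $B$ is uniformly concentrated if there is a function $F$ such that for each nonempty finite antichain $A$, $F(A)$ is an element of $A$, and if $\{A_n\}_{n=1}^\infty$ is a sequence of finite antichains with $|A_n|\ge 2^n$ for each $n$, then $\lim_n F(A_n)=\mathbf 0$. *)

theory Defs
  imports "HOL-Analysis.Analysis" "HOL-Library.Lub_Glb"
begin

text \<open>
  Suprema and infima are taken in the ordering of \<open>B\<close>, i.e.\ inclusion restricted to members
  of \<open>B\<close>. They need not coincide with set-theoretic unions and intersections, and a Boolean
  \<open>\<sigma>\<close>-algebra in the sense below need not be a \<^const>\<open>sigma_algebra\<close> of sets.
\<close>

definition boolean_algebra_on :: "'a set \<Rightarrow> 'a set set \<Rightarrow> bool" where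
  "boolean_algebra_on X B \<longleftrightarrow> X \<noteq> {} \<and> algebra X B"

definition boolean_sigma_algebra :: "'a set \<Rightarrow> 'a set set \<Rightarrow> bool" where
  "boolean_sigma_algebra X B \<longleftrightarrow>
     boolean_algebra_on X B \<and>
     (\<forall>A. A \<subseteq> B \<and> countable A \<longrightarrow> (\<exists>s. isLub B A s) \<and> (\<exists>i. isGlb B A i))"

text \<open>Meaningful only when the supremum, respectively infimum, exists.\<close>

definition Sup_in :: "'a set set \<Rightarrow> 'a set set \<Rightarrow> 'a set" where
  "Sup_in B A = (THE s. isLub B A s)"

definition Inf_in :: "'a set set \<Rightarrow> 'a set set \<Rightarrow> 'a set" where
  "Inf_in B A = (THE i. isGlb B A i)"

lemma Sup_in_eq: "isLub B A s \<Longrightarrow> Sup_in B A = s"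
  unfolding Sup_in_def
  by (rule the_equality) (auto intro: order_antisym dest: isLub_isUb isLub_le_isUb)

lemma Inf_in_eq: "isGlb B A i \<Longrightarrow> Inf_in B A = i"
  unfolding Inf_in_def
  by (rule the_equality) (auto intro: order_antisym dest: isGlb_isLb isGlb_le_isLb)

text \<open>
  Only the values of \<open>m\<close> on \<open>B\<close> matter. The sequence in the last clause is indexed from \<open>0\<close>.
\<close>

definition measure_on :: "'a set \<Rightarrow> 'a set set \<Rightarrow> ('a set \<Rightarrow> real) \<Rightarrow> bool" where
  "measure_on X B m \<longleftrightarrow>
     m {} = 0 \<and> (\<forall>a\<in>B. a \<noteq> {} \<longrightarrow> m a > 0) \<and> m X = 1 \<and>
     (\<forall>a\<in>B. \<forall>b\<in>B. a \<subseteq> b \<longrightarrow> m a \<le> m b) \<and>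
     (\<forall>a\<in>B. \<forall>b\<in>B. a \<inter> b = {} \<longrightarrow> m (a \<union> b) = m a + m b) \<and>
     (\<forall>a :: nat \<Rightarrow> 'a set. range a \<subseteq> B \<and> disjoint_family a \<longrightarrow>
        (\<lambda>n. m (a n)) sums m (Sup_in B (range a)))"

definition measure_algebra :: "'a set \<Rightarrow> 'a set set \<Rightarrow> bool" where
  "measure_algebra X B \<longleftrightarrow> boolean_sigma_algebra X B \<and> (\<exists>m. measure_on X B m)"

definition antichain_in :: "'a set set \<Rightarrow> 'a set set \<Rightarrow> bool" where
  "antichain_in B A \<longleftrightarrow> A \<subseteq> B - {{}} \<and> (\<forall>a\<in>A. \<forall>b\<in>A. a \<noteq> b \<longrightarrow> a \<inter> b = {})"

definition partition_in :: "'a set set \<Rightarrow> 'a set set \<Rightarrow> bool" where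
  "partition_in B W \<longleftrightarrow>
     antichain_in B W \<and> (\<forall>A. antichain_in B A \<and> W \<subseteq> A \<longrightarrow> A = W)"

lemma partition_in_iff_isLub:
  assumes "algebra X B"
  shows "partition_in B W \<longleftrightarrow> antichain_in B W \<and> isLub B W X"
proof -
  interpret algebra X B by fact
  show ?thesis
  proof (intro iffI conjI)
    assume W: "partition_in B W"
    then show ac: "antichain_in B W" by (simp add: partition_in_def)
    have "X \<subseteq> u" if u: "u \<in> B" "\<forall>a\<in>W. a \<subseteq> u" for u
    proof (rule ccontr)
      assume ne: "\<not> X \<subseteq> u"
      have "antichain_in B (insert (X - u) W)"
        using ac u ne by (auto simp: antichain_in_def)
      then have "X - u \<in> W" using W unfolding partition_in_def by blast
      then show False using u ne by blast
    qed
    moreover have "\<forall>a\<in>W. a \<subseteq> X"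
      using ac sets_into_space by (auto simp: antichain_in_def)
    ultimately show "isLub B W X"
      by (auto simp: isLub_def leastP_def isUb_def setle_def setge_def)
  next
    assume W: "antichain_in B W \<and> isLub B W X"
    have "A \<subseteq> W" if A: "antichain_in B A" "W \<subseteq> A" for A
    proof
      fix a assume a: "a \<in> A"
      show "a \<in> W"
      proof (rule ccontr)
        assume n: "a \<notin> W"
        have aB: "a \<in> B" "a \<noteq> {}" "a \<subseteq> X"
          using A(1) a sets_into_space by (auto simp: antichain_in_def)
        have dj: "\<forall>w\<in>W. a \<inter> w = {}"
        proof
          fix w assume "w \<in> W"
          then have "w \<in> A" "a \<noteq> w" using A(2) n by auto
          then show "a \<inter> w = {}" using A(1) a by (simp add: antichain_in_def)
        qed
        have "\<forall>w\<in>W. w \<subseteq> X" using W sets_into_space by (auto simp: antichain_in_def)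
        then have "isUb B W (X - a)"
          using aB dj by (auto simp: isUb_def setle_def)
        then have "X \<subseteq> X - a" using W isLub_le_isUb by blast
        then show False using aB by blast
      qed
    qed
    then show "partition_in B W" using W by (auto simp: partition_in_def)
  qed
qed

definition weakly_distributive :: "'a set set \<Rightarrow> bool" where
  "weakly_distributive B \<longleftrightarrow>
     (\<forall>W :: nat \<Rightarrow> 'a set set. (\<forall>n. partition_in B (W n)) \<longrightarrow>
        (\<exists>V. partition_in B V \<and> (\<forall>a\<in>V. \<forall>n. finite {b \<in> W n. a \<inter> b \<noteq> {}})))"

text \<open>Sequences are indexed from \<open>1\<close>; the value at index \<open>0\<close> is ignored.\<close>

definition limsup_in :: "'a set set \<Rightarrow> (nat \<Rightarrow> 'a set) \<Rightarrow> 'a set" where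
  "limsup_in B a = Inf_in B ((\<lambda>n. Sup_in B (a ` {n..})) ` {1..})"

definition liminf_in :: "'a set set \<Rightarrow> (nat \<Rightarrow> 'a set) \<Rightarrow> 'a set" where
  "liminf_in B a = Sup_in B ((\<lambda>n. Inf_in B (a ` {n..})) ` {1..})"

definition lim_in :: "'a set set \<Rightarrow> (nat \<Rightarrow> 'a set) \<Rightarrow> 'a set \<Rightarrow> bool" where
  "lim_in B a l \<longleftrightarrow> limsup_in B a = l \<and> liminf_in B a = l"

definition uniformly_concentrated :: "'a set set \<Rightarrow> bool" where
  "uniformly_concentrated B \<longleftrightarrow>
     (\<exists>F :: 'a set set \<Rightarrow> 'a set.
        (\<forall>A. antichain_in B A \<and> finite A \<and> A \<noteq> {} \<longrightarrow> F A \<in> A) \<and>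
        (\<forall>A :: nat \<Rightarrow> 'a set set.
           (\<forall>n\<ge>1. antichain_in B (A n) \<and> finite (A n) \<and> card (A n) \<ge> 2 ^ n) \<longrightarrow>
           lim_in B (\<lambda>n. F (A n)) {}))"

end

theory Submission
  imports Defs "HOL-Probability.Discrete_Topology"
begin

text \<open>
  If \<open>m\<close> is a measure, choosing an element of least measure from each finite antichain witnesses
  uniform concentration by the Borel-Cantelli argument, and weak distributivity follows from
  continuity of \<open>m\<close> at zero.

  Conversely, let \<open>U n\<close> consist of the elements below some \<open>F A\<close> with \<open>card A \<ge> 2 ^ n\<close>, and let \<open>V n\<close>
  be its closure under increasing limits. Weak distributivity yields a diagonal property of order
  convergence, from which a sequence with \<open>a n \<in> V n\<close> tends to zero, every sequence tending to
  zero meets each \<open>V n\<close>, and hence some \<open>V m\<close> has all its fourfold unions in \<open>V n\<close>. Antichains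
  outside \<open>V m\<close> have bounded size, so the Kalton-Roberts argument shows that the
  complement of \<open>V n\<close> has positive intersection number. No submeasure has to be constructed for this.
  Kelley's theorem then gives a finitely additive measure bounded below by a positive constant
  outside \<open>V n\<close>. A weighted sum of these is strictly positive, and by weak
  distributivity so is its countably additive part.
\<close>

section \<open>Sublinear functionals\<close>

text \<open>Concentration bounds antichains but says nothing about unions of members of
  \<open>U n\<close>; such control is what a submeasure would supply. The closure \<open>V n\<close>
  is made for this: once null sequences must enter \<open>V n\<close>, a failure of the union bound
  at every index would itself produce a null sequence outside \<open>V n\<close>. Fourfold unions
  are enough because the random bipartite graph behind the splitting has degree four. The decisive
  feature is that a number \<open>l\<close> of labels of order sqrt (N * k) suffices: squaring
  \<open>N \<le> l * r\<close> gives a bound on \<open>N\<close> that is linear in the overlap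
  \<open>k\<close>, which is Kelley's condition. Suprema in \<open>B\<close> need not be unions, so
  limits are expressed by the absence of nonempty members of \<open>B\<close> below a sequence. A
  strictly positive finitely additive measure does not by itself yield a countably additive one: the
  regular open algebra of the line carries the former and not the latter. Weak distributivity
  therefore acts twice, for the properties of \<open>V n\<close> and, through the same diagonal
  property, for the strict positivity of the countably additive part.\<close>

definition sublinear :: "('v::real_vector \<Rightarrow> real) \<Rightarrow> bool" where
  "sublinear p \<longleftrightarrow> (\<forall>x y. p (x + y) \<le> p x + p y) \<and> (\<forall>c x. c \<ge> 0 \<longrightarrow> p (c *\<^sub>R x) = c * p x)"

text \<open>Applying the scaling inequality to \<open>1 / c\<close> gives its converse.\<close>

lemma sublinearI:
  assumes add: "\<And>x y. p (x + y) \<le> p x + p y"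
    and zero: "p 0 = 0"
    and scale: "\<And>c x. c > 0 \<Longrightarrow> p (c *\<^sub>R x) \<le> c * p x"
  shows "sublinear p"
  unfolding sublinear_def
proof (intro conjI allI impI)
  fix c :: real and x assume "c \<ge> 0"
  show "p (c *\<^sub>R x) = c * p x"
  proof (cases "c = 0")
    case False
    then have c: "c > 0" using \<open>c \<ge> 0\<close> by simp
    have "p ((1 / c) *\<^sub>R (c *\<^sub>R x)) \<le> (1 / c) * p (c *\<^sub>R x)"
      using c by (intro scale) simp
    then have "c * p x \<le> p (c *\<^sub>R x)" using c by (simp add: field_simps)
    with scale[OF c, of x] show ?thesis by simp
  qed (simp add: zero)
qed (rule add)

lemma sublinear_add: "sublinear p \<Longrightarrow> p (x + y) \<le> p x + p y"
  by (simp add: sublinear_def)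

lemma sublinear_scale: "sublinear p \<Longrightarrow> c \<ge> 0 \<Longrightarrow> p (c *\<^sub>R x) = c * p x"
  by (simp add: sublinear_def)

lemma sublinear_zero: "sublinear p \<Longrightarrow> p 0 = 0"
  using sublinear_scale[of p 0 0] by simp

lemma sublinear_uminus: "sublinear p \<Longrightarrow> - p (- x) \<le> p x"
  using sublinear_add[of p x "- x"] sublinear_zero[of p] by simp

text \<open>The infimum is finite because subadditivity bounds every term below by
  \<open>- p (- x)\<close>. If \<open>p\<close> is minimal, then \<open>r y = p\<close>, and the
  last claim (the term \<open>t = 1\<close>) becomes superadditivity of \<open>p\<close> in the
  direction \<open>y\<close>.\<close>

lemma sublinear_directional:
  assumes p: "sublinear p"
  defines "r \<equiv> \<lambda>y x. INF t\<in>{0..}. p (x + t *\<^sub>R y) - t * p y"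
  shows "sublinear (r y)" and "r y x \<le> p x" and "r y x \<le> p (x + y) - p y"
proof -
  have r_eq: "r y x = (INF t\<in>{0..}. p (x + t *\<^sub>R y) - t * p y)" for x y
    by (simp add: r_def)
  have lower: "- p (- x) \<le> p (x + t *\<^sub>R y) - t * p y" if "t \<ge> 0" for x t
    using sublinear_add[OF p, of "x + t *\<^sub>R y" "- x"] sublinear_scale[OF p that, of y] by simp
  then have bdd: "bdd_below ((\<lambda>t. p (x + t *\<^sub>R y) - t * p y) ` {0..})" for x
    by (intro bdd_belowI2[of _ "- p (- x)"]) auto
  have le: "r y x \<le> p (x + t *\<^sub>R y) - t * p y" if "t \<ge> 0" for x t
    unfolding r_def using that by (intro cINF_lower[OF bdd]) auto
  show "r y x \<le> p x" using le[of 0 x] by simp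
  show "r y x \<le> p (x + y) - p y" using le[of 1 x] by simp
  show "sublinear (r y)"
  proof (rule sublinearI)
    fix u v
    have sum: "r y (u + v) \<le> (p (u + s *\<^sub>R y) - s * p y) + (p (v + t *\<^sub>R y) - t * p y)"
      if "s \<ge> 0" "t \<ge> 0" for s t
    proof -
      have "r y (u + v) \<le> p ((u + s *\<^sub>R y) + (v + t *\<^sub>R y)) - (s + t) * p y"
        using le[of "s + t" "u + v"] that by (simp add: algebra_simps)
      with sublinear_add[OF p, of "u + s *\<^sub>R y" "v + t *\<^sub>R y"] show ?thesis
        by (simp add: algebra_simps)
    qed
    have "r y (u + v) - r y v \<le> p (u + s *\<^sub>R y) - s * p y" if "s \<ge> 0" for s
    proof -
      have "r y (u + v) - (p (u + s *\<^sub>R y) - s * p y) \<le> r y v"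
        unfolding r_eq[of y v] using sum[OF that] by (intro cINF_greatest) (auto simp: algebra_simps)
      then show ?thesis by simp
    qed
    then have "r y (u + v) - r y v \<le> r y u"
      unfolding r_eq[of y u] by (intro cINF_greatest) auto
    then show "r y (u + v) \<le> r y u + r y v" by simp
  next
    have "0 \<le> r y 0"
      unfolding r_def using sublinear_scale[OF p] by (intro cINF_greatest) auto
    then show "r y 0 = 0" using le[of 0 0] sublinear_zero[OF p] by simp
  next
    fix c :: real and u assume c: "c > 0"
    have "r y (c *\<^sub>R u) / c \<le> p (u + t *\<^sub>R y) - t * p y" if "t \<ge> 0" for t
    proof -
      have "r y (c *\<^sub>R u) \<le> p (c *\<^sub>R (u + t *\<^sub>R y)) - (c * t) * p y"
        using le[of "c * t" "c *\<^sub>R u"] c that by (simp add: algebra_simps)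
      also have "\<dots> = c * (p (u + t *\<^sub>R y) - t * p y)"
        using c by (simp add: sublinear_scale[OF p] algebra_simps del: scaleR_add_right)
      finally show ?thesis using c by (simp add: divide_le_eq mult.commute)
    qed
    then have "r y (c *\<^sub>R u) / c \<le> r y u"
      unfolding r_eq[of y u] by (intro cINF_greatest) auto
    then show "r y (c *\<^sub>R u) \<le> c * r y u" using c by (simp add: field_simps)
  qed
qed

text \<open>All members are bounded below by \<open>- q (- x)\<close>, so the infimum is finite. For
  subadditivity, two members of the chain are comparable, and the smaller one serves both
  arguments.\<close>

lemma sublinear_chain_INF:
  assumes "C \<noteq> {}" and sub: "\<And>p. p \<in> C \<Longrightarrow> sublinear p \<and> p \<le> q"
    and chain: "\<And>p p'. p \<in> C \<Longrightarrow> p' \<in> C \<Longrightarrow> p \<le> p' \<or> p' \<le> p"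
  shows "sublinear (\<lambda>x. INF p\<in>C. p x)" and "p \<in> C \<Longrightarrow> (INF p\<in>C. p x) \<le> p x"
proof -
  have "- q (- x) \<le> p x" if "p \<in> C" for p x
    using sublinear_uminus[of p x] sub[OF that] le_funD[of p q "- x"] by force
  then have bdd: "bdd_below ((\<lambda>p. p x) ` C)" for x
    by (intro bdd_belowI2[of _ "- q (- x)"]) auto
  have le: "(INF p\<in>C. p x) \<le> p x" if "p \<in> C" for p x
    by (rule cINF_lower[OF bdd that])
  then show "p \<in> C \<Longrightarrow> (INF p\<in>C. p x) \<le> p x" .
  show "sublinear (\<lambda>x. INF p\<in>C. p x)"
  proof (rule sublinearI)
    fix x y
    have both: "(INF p\<in>C. p (x + y)) \<le> p x + p' y" if "p \<in> C" "p' \<in> C" for p p'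
      using chain[OF that]
    proof
      assume "p \<le> p'"
      then show ?thesis
        using le[OF that(1), of "x + y"] sublinear_add[of p x y] sub[OF that(1)] le_funD[of p p' y]
        by linarith
    next
      assume "p' \<le> p"
      then show ?thesis
        using le[OF that(2), of "x + y"] sublinear_add[of p' x y] sub[OF that(2)] le_funD[of p' p x]
        by linarith
    qed
    have "(INF p\<in>C. p (x + y)) - (INF p\<in>C. p y) \<le> p x" if "p \<in> C" for p
    proof -
      have "(INF p\<in>C. p (x + y)) - p x \<le> (INF p\<in>C. p y)"
        using both[OF that] \<open>C \<noteq> {}\<close> by (intro cINF_greatest) (auto simp: algebra_simps)
      then show ?thesis by simp
    qed
    then have "(INF p\<in>C. p (x + y)) - (INF p\<in>C. p y) \<le> (INF p\<in>C. p x)"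
      using \<open>C \<noteq> {}\<close> by (intro cINF_greatest) auto
    then show "(INF p\<in>C. p (x + y)) \<le> (INF p\<in>C. p x) + (INF p\<in>C. p y)" by simp
  next
    have "(\<lambda>p. p 0) ` C = {0}" using \<open>C \<noteq> {}\<close> sub sublinear_zero by fastforce
    then show "(INF p\<in>C. p 0) = 0" by simp
  next
    fix c :: real and x assume c: "c > 0"
    have "(INF p\<in>C. p (c *\<^sub>R x)) / c \<le> p x" if "p \<in> C" for p
      using le[OF that, of "c *\<^sub>R x"] sublinear_scale[of p c x] sub[OF that] c
      by (simp add: field_simps)
    then have "(INF p\<in>C. p (c *\<^sub>R x)) / c \<le> (INF p\<in>C. p x)"
      using \<open>C \<noteq> {}\<close> by (intro cINF_greatest) auto
    then show "(INF p\<in>C. p (c *\<^sub>R x)) \<le> c * (INF p\<in>C. p x)"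
      using c by (simp add: field_simps)
  qed
qed

text \<open>A sublinear functional that is minimal below \<open>q\<close> coincides with its directional
  modifications, and is therefore additive.\<close>

lemma sublinear_dominates_linear:
  fixes q :: "'v::real_vector \<Rightarrow> real"
  assumes q: "sublinear q"
  obtains L where "linear L" "\<And>x. L x \<le> q x"
proof -
  let ?A = "{p. sublinear p \<and> p \<le> q}"
  have "\<exists>m\<in>?A. \<forall>a\<in>?A. m \<ge> a \<longrightarrow> a = m"
  proof (rule predicate_Zorn)
    show "partial_order_on ?A (relation_of (\<ge>) ?A)"
      by (rule partial_order_on_relation_ofI) auto
    fix C assume C: "C \<in> Chains (relation_of (\<ge>) ?A)"
    show "\<exists>u\<in>?A. \<forall>a\<in>C. a \<ge> u"
    proof (cases "C = {}")
      case True
      then show ?thesis using q by auto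
    next
      case False
      have sub: "\<And>p. p \<in> C \<Longrightarrow> sublinear p \<and> p \<le> q"
        and ch: "\<And>p p'. p \<in> C \<Longrightarrow> p' \<in> C \<Longrightarrow> p \<le> p' \<or> p' \<le> p"
        using C unfolding Chains_def relation_of_def by blast+
      note inf = sublinear_chain_INF[OF False sub ch]
      have below: "(\<lambda>x. INF p\<in>C. p x) \<le> p" if "p \<in> C" for p
        using inf(2) that by (auto simp: le_fun_def)
      from False obtain p where "p \<in> C" by auto
      with below sub have "(\<lambda>x. INF p\<in>C. p x) \<le> q" using order_trans by blast
      with inf(1) below show ?thesis by blast
    qed
  qed
  then obtain m where m: "sublinear m" "m \<le> q"
    and min: "\<And>p. sublinear p \<Longrightarrow> p \<le> m \<Longrightarrow> p = m"
    by (metis (mono_tags, lifting) mem_Collect_eq order_trans)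
  have add: "m (x + y) = m x + m y" for x y
  proof -
    have "(\<lambda>x. INF t\<in>{0..}. m (x + t *\<^sub>R y) - t * m y) = m"
      using sublinear_directional(1,2)[OF m(1)] by (intro min le_funI)
    then have "m x \<le> m (x + y) - m y"
      using sublinear_directional(3)[OF m(1), of x y] by (metis (no_types, lifting))
    then show ?thesis using sublinear_add[OF m(1), of x y] by simp
  qed
  have neg: "m (- x) = - m x" for x
    using add[of x "- x"] sublinear_zero[OF m(1)] by simp
  have scale: "m (c *\<^sub>R x) = c *\<^sub>R m x" for c x
  proof (cases "c \<ge> 0")
    case False
    then have "m (- (- c *\<^sub>R x)) = c * m x"
      using neg[of "- c *\<^sub>R x"] sublinear_scale[OF m(1), of "- c" x] by simp
    then show ?thesis by simp
  qed (simp add: sublinear_scale[OF m(1)])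
  from add scale have "linear m" by (rule linearI)
  then show thesis using that m(2) by (simp add: le_fun_def)
qed

section \<open>Expanders and the Kalton-Roberts argument\<close>

text \<open>\<open>n ^ n / fact n\<close> is a single term of the series for \<open>exp n\<close>,
  and \<open>exp 1 \<le> 3\<close>.\<close>

lemma power_self_le_fact: "n ^ n \<le> 3 ^ n * (fact n :: nat)"
proof -
  have "real n ^ n / fact n \<le> exp (real n)"
  proof -
    have "(\<Sum>k\<in>{n}. real n ^ k /\<^sub>R fact k) \<le> (\<Sum>k. real n ^ k /\<^sub>R fact k)"
      by (intro sum_le_suminf summable_exp_generic) auto
    then show ?thesis by (simp add: exp_def divide_inverse mult.commute)
  qed
  also have "exp (real n) = exp 1 ^ n"
    by (simp flip: exp_of_nat_mult)
  also have "\<dots> \<le> 3 ^ n"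
    by (intro power_mono exp_le) simp
  finally have "real (n ^ n) \<le> real (3 ^ n * fact n)"
    by (simp add: divide_le_eq)
  then show ?thesis by (simp only: of_nat_le_iff)
qed

text \<open>The product before \<open>2 ^ j\<close> counts triples of a set \<open>E\<close> of size
  \<open>j\<close>, a set \<open>F\<close> of \<open>2 * j\<close> labels and a map sending the
  edges at \<open>E\<close> into \<open>F\<close>; the factor \<open>2 ^ j\<close> is slack for a
  geometric series. The constant is 216 = 4 * 3 * 9 * 2: 4 from \<open>(2 * j) ^ (2 * j)\<close>, 3
  and 9 from replacing \<open>j ^ j\<close> and \<open>(2 * j) ^ (2 * j)\<close> by factorials that
  cancel the binomial denominators, and 2 from the slack.\<close>

lemma expander_count:
  fixes N l j :: nat
  assumes "216 * N * j \<le> l\<^sup>2" "j \<le> N"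
  shows "(N choose j) * (l choose (2 * j)) * ((2 * j) ^ (4 * j) * l ^ (4 * (N - j))) * 2 ^ j \<le> l ^ (4 * N)"
    (is "?T * 2 ^ j \<le> _")
proof -
  have sq: "(2 * j) ^ (4 * j) = 4 ^ j * j ^ j * (j ^ j * (2 * j) ^ (2 * j))"
  proof -
    have "(2 * j) ^ (4 * j) = (2 * j) ^ (2 * j) * (2 * j) ^ (2 * j)"
      by (simp only: power_add[symmetric] mult_2[symmetric] mult.assoc[symmetric]) simp
    also have "(2 * j) ^ (2 * j) * (2 * j) ^ (2 * j) = ((2 * j)\<^sup>2) ^ j * (2 * j) ^ (2 * j)"
      by (simp only: power_mult)
    also have "((2 * j)\<^sup>2) ^ j = 4 ^ j * j ^ j * j ^ j"
      by (simp add: power2_eq_square power_mult_distrib)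
    finally show ?thesis by (simp only: mult.assoc)
  qed
  have "?T * 2 ^ j * (fact j * fact (2 * j)) =
      ((N choose j) * fact j) * ((l choose (2 * j)) * fact (2 * j)) *
      ((2 * j) ^ (4 * j) * l ^ (4 * (N - j)) * 2 ^ j)"
    by (simp only: mult_ac)
  also have "\<dots> \<le> N ^ j * l ^ (2 * j) * ((2 * j) ^ (4 * j) * l ^ (4 * (N - j)) * 2 ^ j)"
    by (intro mult_mono binomial_fact_pow) auto
  also have "\<dots> = N ^ j * l ^ (2 * j) *
      (4 ^ j * j ^ j * (j ^ j * (2 * j) ^ (2 * j)) * l ^ (4 * (N - j)) * 2 ^ j)"
    by (simp only: sq)
  also have "\<dots>
    \<le> N ^ j * l ^ (2 * j) *
      (4 ^ j * j ^ j * ((3 ^ j * fact j) * (3 ^ (2 * j) * fact (2 * j))) * l ^ (4 * (N - j)) * 2 ^ j)"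
    by (intro mult_mono power_self_le_fact order_refl) auto
  also have "\<dots> = (N ^ j * j ^ j * (4 ^ j * 3 ^ j * 3 ^ (2 * j) * 2 ^ j)) * l ^ (2 * j) * l ^ (4 * (N - j)) * (fact j * fact (2 * j))"
    by (simp only: mult_ac)
  also have "N ^ j * j ^ j * (4 ^ j * 3 ^ j * 3 ^ (2 * j) * 2 ^ j) = (216 * N * j) ^ j"
  proof -
    have "(3::nat) ^ (2 * j) = 9 ^ j" by (simp add: power_mult)
    then have "N ^ j * j ^ j * (4 ^ j * 3 ^ j * 3 ^ (2 * j) * 2 ^ j) = (N * j * (4 * 3 * 9 * 2)) ^ j"
      by (simp only: power_mult_distrib)
    also have "N * j * (4 * 3 * 9 * 2) = 216 * N * j" by simp
    finally show ?thesis .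
  qed
  also have "(216 * N * j) ^ j * l ^ (2 * j) * l ^ (4 * (N - j)) * (fact j * fact (2 * j))
    \<le> (l\<^sup>2) ^ j * l ^ (2 * j) * l ^ (4 * (N - j)) * (fact j * fact (2 * j))"
    by (intro mult_mono power_mono assms) auto
  also have "(l\<^sup>2) ^ j * l ^ (2 * j) * l ^ (4 * (N - j)) = l ^ (2 * j + 2 * j + 4 * (N - j))"
    by (simp only: power_mult power_add)
  also have "2 * j + 2 * j + 4 * (N - j) = 4 * N"
    using assms(2) by simp
  finally show ?thesis
    by (simp only: mult_le_cancel2) simp
qed

text \<open>A random map has this expansion property: for fixed \<open>E\<close> and \<open>F\<close> with \<open>card F = 2 * card E\<close>
  the event \<open>h ` (E \<times> {..<4}) \<subseteq> F\<close> is so rare that a union bound over all \<open>E\<close>, \<open>F\<close> suffices.\<close>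

lemma expander_exists:
  fixes N k l :: nat
  assumes "0 < k" "k \<le> N" "216 * N * k \<le> l\<^sup>2"
  obtains h where "h \<in> {..<N} \<times> {..<4::nat} \<rightarrow> {..<l}"
    "\<And>E. E \<subseteq> {..<N} \<Longrightarrow> E \<noteq> {} \<Longrightarrow> card E \<le> k \<Longrightarrow> 2 * card E < card (h ` (E \<times> {..<4}))"
proof -
  define \<Omega> where "\<Omega> = PiE ({..<N} \<times> {..<4::nat}) (\<lambda>_. {..<l})"
  define bad where "bad E F = PiE ({..<N} \<times> {..<4::nat}) (\<lambda>(i, _). if i \<in> E then F else {..<l})" for E F
  define S where "S j = {E. E \<subseteq> {..<N} \<and> card E = j} \<times> {F. F \<subseteq> {..<l} \<and> card F = 2 * j}" for j
  define Bad where "Bad = (\<Union>j\<in>{1..k}. \<Union>(E, F)\<in>S j. bad E F)"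
  have l: "0 < l" using assms by (cases l) auto
  \<comment> \<open>This yields \<open>2 * k \<le> l\<close>, so that a too small image can be
    padded to a set \<open>F\<close> of exactly \<open>2 * card E\<close> labels.\<close>
  have "(2 * k)\<^sup>2 \<le> l\<^sup>2"
  proof -
    have "(2 * k)\<^sup>2 \<le> 216 * k * k" by (simp add: power2_eq_square)
    also have "\<dots> \<le> 216 * N * k" using assms by simp
    finally show ?thesis using assms by simp
  qed
  then have kl: "2 * k \<le> l" by (rule power2_le_imp_le) simp
  have fin: "finite \<Omega>" "card \<Omega> = l ^ (4 * N)"
    by (auto simp: \<Omega>_def card_PiE card_cartesian_product mult.commute intro!: finite_PiE)
  have finS: "finite (S j)" and cardS: "card (S j) = (N choose j) * (l choose (2 * j))" for j
    using n_subsets[of "{..<N}" j] n_subsets[of "{..<l}" "2 * j"]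
    by (auto simp: S_def card_cartesian_product intro!: finite_cartesian_product
        intro: finite_subset[of _ "Pow {..<N}"] finite_subset[of _ "Pow {..<l}"])
  have card_bad: "card (bad E F) = (2 * j) ^ (4 * j) * l ^ (4 * (N - j))"
    if "(E, F) \<in> S j" for E F j
  proof -
    have E: "E \<subseteq> {..<N}" "card E = j" "card F = 2 * j" using that by (auto simp: S_def)
    have "card (bad E F) = (\<Prod>p\<in>{..<N} \<times> {..<4::nat}. card (if fst p \<in> E then F else {..<l}))"
      unfolding bad_def by (subst card_PiE) (auto intro!: prod.cong)
    also have "\<dots> = (\<Prod>i<N. \<Prod>c<4::nat. card (if i \<in> E then F else {..<l}))"
      by (simp only: prod.cartesian_product) (auto intro!: prod.cong)
    also have "\<dots> = (\<Prod>i<N. if i \<in> E then (2 * j) ^ 4 else l ^ 4)"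
      using E by (intro prod.cong) auto
    also have "\<dots> = ((2 * j) ^ 4) ^ card ({..<N} \<inter> E) * (l ^ 4) ^ card ({..<N} \<inter> - E)"
      by (subst prod.If_cases) (auto simp: Collect_conj_eq)
    also have "{..<N} \<inter> E = E" using E by auto
    also have "card ({..<N} \<inter> - E) = N - j"
      using E by (simp add: Diff_eq[symmetric] card_Diff_subset finite_subset)
    finally show ?thesis using E by (simp add: power_mult)
  qed
  have finbad: "finite (bad E F)" if "(E, F) \<in> S j" for E F j
  proof -
    have "finite F" using that by (auto simp: S_def intro: rev_finite_subset[OF finite_lessThan])
    then show ?thesis unfolding bad_def by (intro finite_PiE) auto
  qed
  have half: "real (card (\<Union>(E, F)\<in>S j. bad E F)) \<le> real (l ^ (4 * N)) * (1 / 2) ^ j"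
    if "j \<in> {1..k}" for j
  proof -
    have "card (\<Union>(E, F)\<in>S j. bad E F) \<le> (\<Sum>p\<in>S j. card (case p of (E, F) \<Rightarrow> bad E F))"
      by (rule card_UN_le[OF finS])
    also have "\<dots> = card (S j) * ((2 * j) ^ (4 * j) * l ^ (4 * (N - j)))"
      by (subst sum.cong[OF refl, of _ _ "\<lambda>_. (2 * j) ^ (4 * j) * l ^ (4 * (N - j))"])
        (auto simp: card_bad)
    finally have "card (\<Union>(E, F)\<in>S j. bad E F) * 2 ^ j
      \<le> card (S j) * ((2 * j) ^ (4 * j) * l ^ (4 * (N - j))) * 2 ^ j"
      by simp
    also have "\<dots> \<le> l ^ (4 * N)"
      unfolding cardS
    proof (rule expander_count)
      have "216 * N * j \<le> 216 * N * k" using that by simp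
      then show "216 * N * j \<le> l\<^sup>2" using assms(3) by (rule order_trans)
      show "j \<le> N" using that assms by simp
    qed
    finally have "real (card (\<Union>(E, F)\<in>S j. bad E F) * 2 ^ j) \<le> real (l ^ (4 * N))"
      by (simp only: of_nat_le_iff)
    then show ?thesis by (simp add: power_one_over field_simps)
  qed
  have "card Bad \<le> (\<Sum>j\<in>{1..k}. card (\<Union>(E, F)\<in>S j. bad E F))"
    unfolding Bad_def by (rule card_UN_le) simp
  then have "real (card Bad) \<le> (\<Sum>j\<in>{1..k}. real (card (\<Union>(E, F)\<in>S j. bad E F)))"
    by (simp flip: of_nat_sum)
  also have "\<dots> \<le> (\<Sum>j\<in>{1..k}. real (l ^ (4 * N)) * (1 / 2) ^ j)"
    by (intro sum_mono half)
  also have "\<dots> = real (l ^ (4 * N)) * (\<Sum>j\<in>{1..k}. (1 / 2) ^ j)"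
    by (simp add: sum_distrib_left)
  \<comment> \<open>The sum starts at 1 and is finite, so the bad fractions add up to strictly less
    than 1 and some map is not bad.\<close>
  also have "(\<Sum>j\<in>{1..k}. (1 / 2 :: real) ^ j) = 1 - (1 / 2) ^ k"
    by (induction k) auto
  also have "real (l ^ (4 * N)) * (1 - (1 / 2) ^ k) < real (l ^ (4 * N))"
    using l by simp
  finally have "card Bad < card \<Omega>" using fin by simp
  moreover have "finite Bad"
    unfolding Bad_def using finS finbad by (intro finite_UN_I) auto
  ultimately have "\<not> \<Omega> \<subseteq> Bad" using card_mono by (metis not_le)
  then obtain h where h: "h \<in> \<Omega>" "h \<notin> Bad" by blast
  show thesis
  proof (rule that)
    show hl: "h \<in> {..<N} \<times> {..<4::nat} \<rightarrow> {..<l}" using h by (auto simp: \<Omega>_def)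
    fix E assume E: "E \<subseteq> {..<N}" "E \<noteq> {}" "card E \<le> k"
    show "2 * card E < card (h ` (E \<times> {..<4}))"
    proof (rule ccontr)
      assume "\<not> ?thesis"
      moreover have sub: "h ` (E \<times> {..<4}) \<subseteq> {..<l}" using hl E by blast
      ultimately obtain F where F: "h ` (E \<times> {..<4}) \<subseteq> F" "F \<subseteq> {..<l}" "card F = 2 * card E"
        using exists_subset_between[of "h ` (E \<times> {..<4})" "2 * card E" "{..<l}"] kl E by auto
      have "card E \<in> {1..k}"
        using E by (auto simp: Suc_le_eq card_gt_0_iff finite_subset)
      moreover have "(E, F) \<in> S (card E)" using E F by (auto simp: S_def)
      moreover have "h \<in> bad E F"
        using h(1) F(1) unfolding bad_def \<Omega>_def by (auto simp: PiE_iff image_subset_iff)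
      ultimately have "h \<in> Bad" unfolding Bad_def by blast
      then show False using h by simp
    qed
  qed
qed

text \<open>At most \<open>4 * card E\<close> incidences are spread over more than
  \<open>2 * card E\<close> labels, so some label belongs to a single \<open>R e\<close>. That label
  is given to \<open>e\<close>; no other index can use it, and the expansion hypothesis passes to
  \<open>E - {e}\<close>.\<close>

lemma injective_choice_of_expansion:
  assumes "finite E" and "\<And>i. i \<in> E \<Longrightarrow> finite (R i) \<and> card (R i) \<le> 4"
    and "\<And>E'. E' \<subseteq> E \<Longrightarrow> E' \<noteq> {} \<Longrightarrow> 2 * card E' < card (\<Union>i\<in>E'. R i)"
  shows "\<exists>f. inj_on f E \<and> (\<forall>i\<in>E. f i \<in> R i)"
  using assms
proof (induction "card E" arbitrary: E)
  case 0
  then show ?case by simp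
next
  case (Suc n)
  let ?J = "\<Union>i\<in>E. R i"
  have ne: "E \<noteq> {}" using Suc.hyps(2) by auto
  have finJ: "finite ?J" using Suc.prems by auto
  have "\<exists>j\<in>?J. card {i \<in> E. j \<in> R i} < 2"
  proof (rule ccontr)
    assume "\<not> ?thesis"
    then have "(\<Sum>j\<in>?J. 2) \<le> (\<Sum>j\<in>?J. card {i \<in> E. j \<in> R i})"
      by (intro sum_mono) force
    also have "\<dots> = (\<Sum>i\<in>E. card {j \<in> ?J. j \<in> R i})"
      using sum_multicount_gen[of E ?J "\<lambda>i j. j \<in> R i" "\<lambda>j. card {i \<in> E. j \<in> R i}"]
        finJ Suc.prems(1) by simp
    also have "\<dots> \<le> (\<Sum>i\<in>E. 4)"
    proof (intro sum_mono)
      fix i assume "i \<in> E"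
      then have "card {j \<in> ?J. j \<in> R i} \<le> card (R i)"
        using Suc.prems(2) by (intro card_mono) auto
      then show "card {j \<in> ?J. j \<in> R i} \<le> 4" using Suc.prems(2)[OF \<open>i \<in> E\<close>] by simp
    qed
    finally show False using Suc.prems(3)[OF order_refl ne] by simp
  qed
  then obtain j where j: "j \<in> ?J" "card {i \<in> E. j \<in> R i} < 2" by blast
  then obtain e where e: "e \<in> E" "j \<in> R e" by blast
  have uniq: "j \<notin> R i" if "i \<in> E" "i \<noteq> e" for i
  proof
    assume "j \<in> R i"
    then have "card {i, e} \<le> card {i \<in> E. j \<in> R i}"
      using that e Suc.prems(1) by (intro card_mono) auto
    then show False using j(2) that by simp
  qed
  have "\<exists>f. inj_on f (E - {e}) \<and> (\<forall>i\<in>E - {e}. f i \<in> R i)"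
    using Suc.hyps(2) e Suc.prems by (intro Suc.hyps(1)) auto
  then obtain f where f: "inj_on f (E - {e})" "\<forall>i\<in>E - {e}. f i \<in> R i" by blast
  have "inj_on (f(e := j)) E"
    using f uniq by (auto simp: inj_on_def)
  then show ?case
    using f e by (intro exI[of _ "f(e := j)"]) auto
qed

lemma floor_sqrt_bounds:
  fixes n :: nat
  obtains s where "s\<^sup>2 \<le> n" "n < (Suc s)\<^sup>2"
proof -
  have "\<exists>s. s\<^sup>2 \<le> n \<and> n < (Suc s)\<^sup>2"
  proof (induction n)
    case (Suc n)
    then obtain s where s: "s\<^sup>2 \<le> n" "n < (Suc s)\<^sup>2" by blast
    show ?case
    proof (cases "Suc n < (Suc s)\<^sup>2")
      case False
      then have "Suc n = (Suc s)\<^sup>2" using s by simp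
      moreover have "(Suc s)\<^sup>2 < (Suc (Suc s))\<^sup>2" by (simp add: power2_eq_square)
      ultimately show ?thesis by (intro exI[of _ "Suc s"]) simp
    qed (use s in \<open>auto intro: exI[of _ s]\<close>)
  qed (auto intro: exI[of _ 0])
  then show thesis using that by blast
qed

text \<open>The Kalton-Roberts argument. If every point lies in at most \<open>k\<close> of the sets \<open>c i\<close>, then the
  injections supplied by an expander cut each \<open>c i\<close> into four pieces, labelled by elements of
  \<open>{..<l}\<close>, such that pieces of different sets with the same label are disjoint. One piece
  of each \<open>c i\<close> lies in \<open>D\<close>, and each label is used fewer than \<open>r\<close> times by those pieces, so \<open>N\<close> is at
  most \<open>l * r\<close>, where \<open>l\<close> is of order \<open>sqrt (N * k)\<close>.\<close>

lemma (in algebra) kalton_roberts: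
  assumes split: "\<And>a. (\<And>q. q < 4 \<Longrightarrow> a q \<in> M) \<Longrightarrow> (\<Union>q<4::nat. a q) \<in> C \<Longrightarrow> \<exists>q<4. a q \<in> D"
    and D: "D \<subseteq> M" "{} \<notin> D"
    and r: "\<And>A. antichain_in M A \<Longrightarrow> finite A \<Longrightarrow> A \<subseteq> D \<Longrightarrow> card A \<le> r"
    and c: "\<And>i. i < N \<Longrightarrow> c i \<in> C" "C \<subseteq> M" and N: "0 < N"
  shows "\<exists>x\<in>\<Omega>. N \<le> 900 * r\<^sup>2 * card {i. i < N \<and> x \<in> c i}"
proof -
  define E where "E x = {i. i < N \<and> x \<in> c i}" for x
  have ESub: "E x \<subseteq> {..<N}" for x by (auto simp: E_def)
  have finE: "finite (E x)" for x by (simp add: E_def)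
  have cne: "c i \<noteq> {}" if "i < N" for i
  proof
    assume "c i = {}"
    then have "(\<Union>q<4::nat. {}) \<in> C" using c(1)[OF that] by simp
    with split[of "\<lambda>_. {}"] D(2) show False by auto
  qed
  have cM: "c i \<in> M" "c i \<subseteq> \<Omega>" if "i < N" for i
    using c that sets_into_space by blast+
  obtain x0 where x0: "x0 \<in> c 0" using cne[OF N] by blast
  then have "x0 \<in> \<Omega>" "0 \<in> E x0" using cM[OF N] N by (auto simp: E_def)
  have leN: "card (E x) \<le> N" for x
    using card_mono[OF _ ESub[of x]] by simp
  define k where "k = Max ((\<lambda>x. card (E x)) ` \<Omega>)"
  have finI: "finite ((\<lambda>x. card (E x)) ` \<Omega>)"
    using leN by (auto intro!: finite_subset[OF _ finite_atMost[of N]])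
  have Ek: "card (E x) \<le> k" if "x \<in> \<Omega>" for x
    unfolding k_def using finI that by (intro Max_ge) auto
  have "k \<in> (\<lambda>x. card (E x)) ` \<Omega>"
    unfolding k_def using finI \<open>x0 \<in> \<Omega>\<close> by (intro Max_in) auto
  then obtain x where x: "x \<in> \<Omega>" "card (E x) = k" by auto
  have k: "0 < k" "k \<le> N"
  proof -
    have "card (E x0) > 0"
      using \<open>0 \<in> E x0\<close> finE by (auto simp: card_gt_0_iff)
    then show "0 < k" using Ek[OF \<open>x0 \<in> \<Omega>\<close>] by simp
    show "k \<le> N" using leN[of x] x by simp
  qed
  obtain s where s: "s\<^sup>2 \<le> N * k" "N * k < (Suc s)\<^sup>2" by (rule floor_sqrt_bounds)
  have "1 \<le> s"
  proof (rule ccontr)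
    assume "\<not> 1 \<le> s"
    then have "s = 0" by simp
    then have "N * k < 1" using s(2) by simp
    then show False using k N by simp
  qed
  \<comment> \<open>Since 15 squared is 225, \<open>l\<close> meets the bound with 216 in
    \<open>expander_exists\<close>. As \<open>1 \<le> s\<close>, also \<open>l \<le> 30 * s\<close>,
    and squaring 30 gives the final constant 900.\<close>
  define l where "l = 15 * Suc s"
  have "216 * N * k \<le> 225 * (Suc s)\<^sup>2" using s(2) by simp
  also have "\<dots> = l\<^sup>2" unfolding l_def power_mult_distrib by simp
  finally obtain h where h: "h \<in> {..<N} \<times> {..<4::nat} \<rightarrow> {..<l}"
    and exp: "\<And>E. E \<subseteq> {..<N} \<Longrightarrow> E \<noteq> {} \<Longrightarrow> card E \<le> k \<Longrightarrow> 2 * card E < card (h ` (E \<times> {..<4}))"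
    using expander_exists[OF k] by blast
  define R where "R i = h ` ({i} \<times> {..<4::nat})" for i
  have "\<exists>f. inj_on f E \<and> (\<forall>i\<in>E. f i \<in> R i)" if "E \<subseteq> {..<N}" "card E \<le> k" for E
  proof (rule injective_choice_of_expansion)
    show "finite E" using that finite_subset by blast
    show "finite (R i) \<and> card (R i) \<le> 4" for i
      unfolding R_def using card_image_le[of "{i} \<times> {..<4::nat}" h]
      by (simp add: card_cartesian_product)
    fix E' assume E': "E' \<subseteq> E" "E' \<noteq> {}"
    then have "card E' \<le> k" using that card_mono[OF \<open>finite E\<close>, of E'] by linarith
    moreover have "(\<Union>i\<in>E'. R i) = h ` (E' \<times> {..<4})" by (auto simp: R_def)
    ultimately show "2 * card E' < card (\<Union>i\<in>E'. R i)" using exp[of E'] E' that by auto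
  qed
  then have "\<forall>E. \<exists>f. E \<subseteq> {..<N} \<and> card E \<le> k \<longrightarrow> inj_on f E \<and> (\<forall>i\<in>E. f i \<in> R i)"
    by blast
  then obtain f where "\<forall>E. E \<subseteq> {..<N} \<and> card E \<le> k \<longrightarrow> inj_on (f E) E \<and> (\<forall>i\<in>E. f E i \<in> R i)"
    by metis
  then have f: "inj_on (f (E x)) (E x)" "\<And>i. i \<in> E x \<Longrightarrow> f (E x) i \<in> R i" if "x \<in> \<Omega>" for x
    using ESub Ek[OF that] by blast+
  define a where "a i j = {x \<in> \<Omega>. i \<in> E x \<and> f (E x) i = j}" for i j
  \<comment> \<open>The injection depends on a point only through its membership pattern
    \<open>E x\<close>. There are finitely many patterns, and each is a finite Boolean condition on
    the sets \<open>c n\<close>.\<close>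
  have aM: "a i j \<in> M" for i j
  proof -
    have "{x \<in> \<Omega>. \<exists>G\<in>{G \<in> Pow {..<N}. i \<in> G \<and> f G i = j}. \<forall>n\<in>{..<N}. x \<in> c n \<longleftrightarrow> n \<in> G} \<in> M"
    proof (intro sets_Collect_finite_Ex sets_Collect_finite_All)
      fix G n assume "n \<in> {..<N}"
      then have "{x \<in> \<Omega>. x \<in> c n \<longleftrightarrow> n \<in> G} = (if n \<in> G then c n else \<Omega> - c n)"
        using cM by auto
      then show "{x \<in> \<Omega>. x \<in> c n \<longleftrightarrow> n \<in> G} \<in> M"
        using cM \<open>n \<in> {..<N}\<close> by auto
    qed auto
    also have "{x \<in> \<Omega>. \<exists>G\<in>{G \<in> Pow {..<N}. i \<in> G \<and> f G i = j}. \<forall>n\<in>{..<N}. x \<in> c n \<longleftrightarrow> n \<in> G} = a i j"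
    proof -
      have "(\<forall>n\<in>{..<N}. x \<in> c n \<longleftrightarrow> n \<in> G) \<longleftrightarrow> G = E x" if "G \<in> Pow {..<N}" for G x
        using that by (auto simp: E_def)
      then show ?thesis using ESub by (auto simp: a_def)
    qed
    finally show ?thesis .
  qed
  have "\<exists>j<l. a i j \<in> D" if i: "i < N" for i
  proof -
    have "(\<Union>q<4::nat. a i (h (i, q))) = c i"
    proof (intro equalityI subsetI)
      fix y assume y: "y \<in> c i"
      then have "y \<in> \<Omega>" "i \<in> E y" using cM that by (auto simp: E_def)
      then show "y \<in> (\<Union>q<4::nat. a i (h (i, q)))" using f(2) by (auto simp: a_def R_def)
    qed (auto simp: a_def E_def)
    then obtain q where q: "q < 4" "a i (h (i, q)) \<in> D"
      using split[of "\<lambda>q. a i (h (i, q))"] aM c(1)[OF i] by auto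
    then show ?thesis using h i by (intro exI[of _ "h (i, q)"]) auto
  qed
  then obtain g where g: "\<And>i. i < N \<Longrightarrow> g i < l" "\<And>i. i < N \<Longrightarrow> a i (g i) \<in> D" by metis
  have label: "card {i. i < N \<and> g i = j} \<le> r" for j
  proof -
    let ?I = "{i. i < N \<and> g i = j}"
    have ne: "a i j \<in> D" "a i j \<noteq> {}" if "i \<in> ?I" for i
    proof -
      have "i < N" "g i = j" using that by auto
      with g(2)[of i] show "a i j \<in> D" by simp
      with D(2) show "a i j \<noteq> {}" by metis
    qed
    have dj: "a i j \<inter> a i' j = {}" if "i \<noteq> i'" for i i'
    proof (rule ccontr)
      assume "a i j \<inter> a i' j \<noteq> {}"
      then obtain y where "y \<in> a i j" "y \<in> a i' j" by blast
      then have y: "y \<in> \<Omega>" "f (E y) i = f (E y) i'" "i \<in> E y" "i' \<in> E y"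
        by (simp_all add: a_def)
      then show False using inj_onD[OF f(1)[OF y(1)] y(2-4)] that by simp
    qed
    have "inj_on (\<lambda>i. a i j) ?I"
    proof (rule inj_onI, rule ccontr)
      fix i i' assume "i \<in> ?I" "i' \<in> ?I" "a i j = a i' j" "i \<noteq> i'"
      then show False using ne[of i] dj[of i i'] by simp
    qed
    then have "card ?I = card ((\<lambda>i. a i j) ` ?I)" by (rule card_image[symmetric])
    also have "\<dots> \<le> r"
    proof (rule r)
      show "antichain_in M ((\<lambda>i. a i j) ` ?I)"
        unfolding antichain_in_def
      proof (intro conjI ballI impI)
        show "(\<lambda>i. a i j) ` ?I \<subseteq> M - {{}}" using ne(2) aM by blast
        fix u v assume "u \<in> (\<lambda>i. a i j) ` ?I" "v \<in> (\<lambda>i. a i j) ` ?I" "u \<noteq> v"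
        then obtain i i' where "u = a i j" "v = a i' j" by blast
        with \<open>u \<noteq> v\<close> show "u \<inter> v = {}" using dj[of i i'] by auto
      qed
    qed (use ne in auto)
    finally show ?thesis .
  qed
  have "{..<N} = (\<Union>j<l. {i. i < N \<and> g i = j})" using g(1) by auto
  then have "N = card (\<Union>j<l. {i. i < N \<and> g i = j})" using card_lessThan by metis
  also have "\<dots> \<le> (\<Sum>j<l. card {i. i < N \<and> g i = j})" by (rule card_UN_le) simp
  also have "\<dots> \<le> l * r" using sum_bounded_above[of "{..<l}" _ r] label by simp
  also have "\<dots> \<le> 30 * s * r" using \<open>1 \<le> s\<close> by (simp add: l_def)
  finally have "N\<^sup>2 \<le> (30 * s * r)\<^sup>2" by (rule power_mono) simp
  also have "\<dots> = 900 * r\<^sup>2 * s\<^sup>2" by (simp add: power_mult_distrib)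
  also have "\<dots> \<le> 900 * r\<^sup>2 * (N * k)" using s(1) by simp
  finally have "N * N \<le> N * (900 * r\<^sup>2 * k)" by (simp add: power2_eq_square mult_ac)
  then have "N \<le> 900 * r\<^sup>2 * k" using N by simp
  then show ?thesis using x by (auto simp: E_def)
qed

section \<open>Order convergence and weak distributivity\<close>

lemma antichain_inD:
  assumes "antichain_in B A" "a \<in> A"
  shows "a \<in> B" "a \<noteq> {}" "b \<in> A \<Longrightarrow> a \<noteq> b \<Longrightarrow> a \<inter> b = {}"
  using assms by (auto simp: antichain_in_def)

lemma antichain_in_subset: "antichain_in B A \<Longrightarrow> A' \<subseteq> A \<Longrightarrow> antichain_in B A'"
  unfolding antichain_in_def by (meson subset_iff)

text \<open>For a sequence in an algebra \<open>B\<close> this says that its infimum in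
  \<open>B\<close> is empty. The set-theoretic intersection may be nonempty as long as it contains
  no nonempty member of \<open>B\<close>.\<close>

definition vanishing :: "'a set set \<Rightarrow> (nat \<Rightarrow> 'a set) \<Rightarrow> bool" where
  "vanishing B d \<longleftrightarrow> (\<forall>b\<in>B. (\<forall>n. b \<subseteq> d n) \<longrightarrow> b = {})"

text \<open>Convergence to zero in the order sense, phrased through a dominating sequence so that no
  infinite suprema are involved.\<close>

definition null_seq :: "'a set set \<Rightarrow> (nat \<Rightarrow> 'a set) \<Rightarrow> bool" where
  "null_seq B a \<longleftrightarrow> range a \<subseteq> B \<and>
     (\<exists>d. range d \<subseteq> B \<and> decseq d \<and> vanishing B d \<and> (\<forall>n. a n \<subseteq> d n))"

lemma null_seqI:
  assumes "range a \<subseteq> B" "range d \<subseteq> B" "decseq d" "vanishing B d" "\<And>n. a n \<subseteq> d n"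
  shows "null_seq B a"
  using assms unfolding null_seq_def by blast

lemma vanishingD: "vanishing B d \<Longrightarrow> b \<in> B \<Longrightarrow> (\<And>n. b \<subseteq> d n) \<Longrightarrow> b = {}"
  by (auto simp: vanishing_def)

lemma null_seq_mono:
  assumes "null_seq B a" "range b \<subseteq> B" "\<And>n. b n \<subseteq> a n"
  shows "null_seq B b"
proof -
  obtain d where d: "range d \<subseteq> B" "decseq d" "vanishing B d" "\<And>n. a n \<subseteq> d n"
    using assms(1) unfolding null_seq_def by blast
  from d(4) assms(3) have "b n \<subseteq> d n" for n by (rule subset_trans[rotated])
  with assms(2) d(1-3) show ?thesis by (rule null_seqI)
qed

lemma null_seq_const:
  assumes "null_seq B (\<lambda>_. b)"
  shows "b = {}"
proof -
  obtain d where d: "vanishing B d" "\<And>n. b \<subseteq> d n"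
    using assms unfolding null_seq_def by auto
  have "b \<in> B" using assms by (auto simp: null_seq_def)
  then show ?thesis using d by (intro vanishingD)
qed

context algebra
begin

text \<open>Monotonicity decouples the two dominating sequences: if \<open>c\<close> lies below
  every \<open>d n \<union> e n\<close>, then \<open>c - d k\<close> lies below every
  \<open>e n\<close> for each fixed \<open>k\<close>, hence is empty, and \<open>c\<close> lies
  below every \<open>d k\<close>.\<close>

lemma null_seq_Un:
  assumes "null_seq M a" "null_seq M b"
  shows "null_seq M (\<lambda>n. a n \<union> b n)"
proof -
  obtain d where d: "range d \<subseteq> M" "decseq d" "vanishing M d" "\<And>n. a n \<subseteq> d n"
    using assms(1) unfolding null_seq_def by blast
  obtain e where e: "range e \<subseteq> M" "decseq e" "vanishing M e" "\<And>n. b n \<subseteq> e n"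
    using assms(2) unfolding null_seq_def by blast
  show ?thesis
  proof (rule null_seqI)
    show "range (\<lambda>n. a n \<union> b n) \<subseteq> M" using assms by (auto simp: null_seq_def)
    show "range (\<lambda>n. d n \<union> e n) \<subseteq> M" using d(1) e(1) by auto
    show "decseq (\<lambda>n. d n \<union> e n)" using d(2) e(2) unfolding decseq_def by blast
    show "a n \<union> b n \<subseteq> d n \<union> e n" for n using d(4)[of n] e(4)[of n] by blast
    show "vanishing M (\<lambda>n. d n \<union> e n)"
      unfolding vanishing_def
    proof (intro ballI impI)
      fix c assume c: "c \<in> M" "\<forall>n. c \<subseteq> d n \<union> e n"
      have "c \<subseteq> d k" for k
      proof -
        have "c - d k \<subseteq> e n" for n
        proof -
          have "c \<subseteq> d (max n k) \<union> e (max n k)" using c(2) by blast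
          moreover have "d (max n k) \<subseteq> d k" "e (max n k) \<subseteq> e n"
            using d(2) e(2) by (auto simp: decseq_def)
          ultimately show ?thesis by blast
        qed
        moreover have "c - d k \<in> M" using c(1) d(1) by auto
        ultimately have "c - d k = {}" using vanishingD[OF e(3)] by blast
        then show ?thesis by blast
      qed
      then show "c = {}" using vanishingD[OF d(3) c(1)] by blast
    qed
  qed
qed

lemma null_seq_finite_UN:
  assumes "\<And>q. q < Q \<Longrightarrow> null_seq M (a q)"
  shows "null_seq M (\<lambda>n. \<Union>q<Q::nat. a q n)"
  using assms
proof (induction Q)
  case 0
  show ?case by (rule null_seqI[of _ _ "\<lambda>_. {}"]) (auto simp: vanishing_def decseq_def)
next
  case (Suc Q)
  then have "null_seq M (\<lambda>n. a Q n \<union> (\<Union>q<Q. a q n))" by (intro null_seq_Un) auto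
  then show ?case by (simp add: lessThan_Suc)
qed

lemma partition_meets:
  assumes "partition_in M W" "b \<in> M" "\<And>w. w \<in> W \<Longrightarrow> b \<inter> w = {}"
  shows "b = {}"
proof (rule ccontr)
  assume "b \<noteq> {}"
  then have "antichain_in M (insert b W)"
    using assms unfolding partition_in_def antichain_in_def by (auto simp: Int_commute)
  then have "b \<in> W" using assms(1) unfolding partition_in_def by blast
  then show False using assms(3) \<open>b \<noteq> {}\<close> by blast
qed

lemma partition_inI:
  assumes W: "antichain_in M W" and meets: "\<And>b. b \<in> M \<Longrightarrow> (\<And>w. w \<in> W \<Longrightarrow> b \<inter> w = {}) \<Longrightarrow> b = {}"
  shows "partition_in M W"
  unfolding partition_in_def
proof (intro conjI allI impI W)
  fix A assume A: "antichain_in M A \<and> W \<subseteq> A"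
  have "a \<in> W" if "a \<in> A" for a
  proof (rule ccontr)
    assume "a \<notin> W"
    have "a \<inter> w = {}" if "w \<in> W" for w
    proof (rule antichain_inD(3))
      show "antichain_in M A" "w \<in> A" using A \<open>w \<in> W\<close> by auto
      show "a \<noteq> w" using \<open>a \<notin> W\<close> \<open>w \<in> W\<close> by blast
    qed fact
    moreover have "a \<in> M" "a \<noteq> {}" using A that by (auto simp: antichain_in_def)
    ultimately show False using meets by blast
  qed
  then show "A = W" using A by blast
qed

text \<open>This gives a vanishing sequence the form to which weak distributivity applies. An
  element that misses all layers is pushed by induction into every \<open>d n\<close>. Repeated
  terms of \<open>d\<close> produce empty layers, which are removed.\<close>

lemma partition_of_differences:
  assumes d: "range d \<subseteq> M" "decseq d" "vanishing M d"
  defines "W \<equiv> insert (\<Omega> - d 0) (range (\<lambda>k. d k - d (Suc k))) - {{}}"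
  shows "partition_in M W"
proof (rule partition_inI)
  have WM: "W \<subseteq> M" using d(1) by (auto simp: W_def)
  have step: "(d k - d (Suc k)) \<inter> (d l - d (Suc l)) = {}" if "k < l" for k l
    using decseqD[OF d(2), of "Suc k" l] that by auto
  have dj: "(d k - d (Suc k)) \<inter> (d l - d (Suc l)) = {}" if "k \<noteq> l" for k l
    using step[of k l] step[of l k] that by (cases "k < l") auto
  have dj0: "(\<Omega> - d 0) \<inter> (d k - d (Suc k)) = {}" for k
    using decseqD[OF d(2), of 0 k] by auto
  show "antichain_in M W"
    unfolding antichain_in_def
  proof (intro conjI ballI impI)
    show "W \<subseteq> M - {{}}" using WM by (auto simp: W_def)
    fix a b assume ab: "a \<in> W" "b \<in> W" "a \<noteq> b"
    consider "a = \<Omega> - d 0" | k where "a = d k - d (Suc k)" using ab(1) by (auto simp: W_def)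
    then show "a \<inter> b = {}"
    proof cases
      case 1
      then show ?thesis using ab(2,3) dj0 by (auto simp: W_def)
    next
      case (2 k)
      consider "b = \<Omega> - d 0" | l where "b = d l - d (Suc l)" using ab(2) by (auto simp: W_def)
      then show ?thesis
      proof cases
        case 1
        with 2 dj0 show ?thesis by blast
      next
        case (2 l)
        with \<open>a = _\<close> ab(3) have "k \<noteq> l" by blast
        with 2 \<open>a = _\<close> dj show ?thesis by blast
      qed
    qed
  qed
  fix a assume aM: "a \<in> M" and disj: "\<And>w. w \<in> W \<Longrightarrow> a \<inter> w = {}"
  have "a \<subseteq> d n" for n
  proof (induction n)
    case 0
    have "a \<inter> (\<Omega> - d 0) = {}" using disj[of "\<Omega> - d 0"] by (cases "\<Omega> - d 0 = {}") (auto simp: W_def)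
    then show ?case using aM sets_into_space by blast
  next
    case (Suc n)
    have "a \<inter> (d n - d (Suc n)) = {}"
      using disj[of "d n - d (Suc n)"] by (cases "d n - d (Suc n) = {}") (auto simp: W_def)
    then show ?case using Suc by blast
  qed
  then show "a = {}" by (intro vanishingD[OF d(3) aM])
qed

text \<open>Applied to the layers of all \<open>d n\<close>, weak distributivity gives a partition
  \<open>V\<close> each of whose elements misses \<open>d n k\<close> for some \<open>k\<close>.
  Enumerate \<open>V\<close> and let \<open>g n\<close> be so large that \<open>d n (g n)\<close>
  misses the first \<open>n + 1\<close> elements. The complements of these finite unions then
  dominate, and they vanish because \<open>V\<close> is a partition.\<close>

lemma weakly_distributive_diagonal:
  assumes wd: "weakly_distributive M" and ccc: "\<And>A. antichain_in M A \<Longrightarrow> countable A"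
    and d: "\<And>n. range (d n) \<subseteq> M" "\<And>n. decseq (d n)" "\<And>n. vanishing M (d n)"
  obtains g where "null_seq M (\<lambda>n. d n (g n))"
proof -
  define W where "W n = insert (\<Omega> - d n 0) (range (\<lambda>k. d n k - d n (Suc k))) - {{}}" for n
  have "partition_in M (W n)" for n
    unfolding W_def using d by (rule partition_of_differences)
  then obtain V where V: "partition_in M V" "\<And>a n. a \<in> V \<Longrightarrow> finite {b \<in> W n. a \<inter> b \<noteq> {}}"
    using wd unfolding weakly_distributive_def by meson
  have VM: "V \<subseteq> M" "countable V" using V(1) ccc by (auto simp: partition_in_def antichain_in_def)
  have escape: "\<exists>k. v \<inter> d n k = {}" if v: "v \<in> V" for v n
  proof -
    let ?b = "\<lambda>k. d n k - d n (Suc k)"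
    let ?K = "{k. v \<inter> ?b k \<noteq> {}}"
    have "inj_on ?b ?K"
    proof (rule linorder_inj_onI')
      fix k l assume kl: "k < l" "k \<in> ?K" "l \<in> ?K"
      have "d n l \<subseteq> d n (Suc k)" using decseqD[OF d(2)] kl(1) by simp
      then show "?b k \<noteq> ?b l" using kl by blast
    qed
    moreover have "?b ` ?K \<subseteq> {b \<in> W n. v \<inter> b \<noteq> {}}" by (auto simp: W_def)
    then have "finite (?b ` ?K)" by (rule finite_subset) (rule V(2)[OF v])
    ultimately have "finite ?K" by (rule finite_imageD[rotated])
    from finite_nat_set_iff_bounded[THEN iffD1, OF this]
    obtain K where K: "\<forall>k\<in>?K. k < K" ..
    \<comment> \<open>Past \<open>K\<close> no layer meets \<open>v\<close>, so the trace of
      \<open>d n k\<close> on \<open>v\<close> no longer shrinks; lying below all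
      \<open>d n k\<close>, it is empty.\<close>
    have "v \<inter> d n K \<subseteq> d n k" for k
    proof (cases "k \<le> K")
      case True
      then show ?thesis using decseqD[OF d(2) True, of n] by blast
    next
      case False
      then have "K \<le> k" by simp
      then show ?thesis
      proof (induction k rule: dec_induct)
        case (step k)
        have "v \<inter> ?b k = {}"
        proof (rule ccontr)
          assume "v \<inter> ?b k \<noteq> {}"
          then have "k < K" by (intro bspec[OF K] CollectI)
          then show False using step(1) by simp
        qed
        then show ?case using step by blast
      qed blast
    qed
    moreover have "v \<inter> d n K \<in> M" using v VM d(1) by blast
    ultimately have "v \<inter> d n K = {}" using vanishingD[OF d(3)] by blast
    then show ?thesis by blast
  qed
  \<comment> \<open>The default in the degenerate case is the empty set, which misses every
    \<open>d n k\<close>.\<close>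
  define e where "e j = (if V = {} then {} else from_nat_into V j)" for j
  have eV: "V = {} \<or> e j \<in> V" for j by (simp add: e_def from_nat_into)
  have e_empty: "e j = {}" if "V = {}" for j using that by (simp add: e_def)
  have eM: "e j \<in> M" for j using eV[of j] VM e_empty[of j] by auto
  have "\<exists>k. e j \<inter> d n k = {}" for j n using eV[of j] escape e_empty[of j] by auto
  then obtain k where k: "\<And>j n. e j \<inter> d n (k j n) = {}" by metis
  define g where "g n = Max ((\<lambda>j. k j n) ` {..n})" for n
  have g: "e j \<inter> d n (g n) = {}" if "j \<le> n" for j n
  proof -
    have "k j n \<le> g n" unfolding g_def using that by (intro Max_ge) auto
    then have "d n (g n) \<subseteq> d n (k j n)" using decseqD[OF d(2)] by blast
    then show ?thesis using k[of j n] by blast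
  qed
  show thesis
  proof (rule that, rule null_seqI)
    show "range (\<lambda>n. d n (g n)) \<subseteq> M" using d(1) by blast
    show "range (\<lambda>n. \<Omega> - (\<Union>j\<le>n. e j)) \<subseteq> M" using eM by auto
    show "decseq (\<lambda>n. \<Omega> - (\<Union>j\<le>n. e j))" by (force simp: decseq_def)
    show "d n (g n) \<subseteq> \<Omega> - (\<Union>j\<le>n. e j)" for n
    proof
      fix x assume x: "x \<in> d n (g n)"
      have "d n (g n) \<in> M" using d(1) by blast
      then have "x \<in> \<Omega>" using x sets_into_space by blast
      moreover have "x \<notin> e j" if "j \<le> n" for j using g[OF that] x by blast
      ultimately show "x \<in> \<Omega> - (\<Union>j\<le>n. e j)" by simp
    qed
    show "vanishing M (\<lambda>n. \<Omega> - (\<Union>j\<le>n. e j))"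
      unfolding vanishing_def
    proof (intro ballI impI)
      fix b assume b: "b \<in> M" "\<forall>n. b \<subseteq> \<Omega> - (\<Union>j\<le>n. e j)"
      show "b = {}"
      proof (rule partition_meets[OF V(1) b(1)])
        fix w assume "w \<in> V"
        then obtain j where "from_nat_into V j = w"
          using from_nat_into_surj[OF VM(2)] by blast
        then have "w = e j" using \<open>w \<in> V\<close> by (auto simp: e_def)
        then show "b \<inter> w = {}" using b(2)[rule_format, of j] by auto
      qed
    qed
  qed
qed

end

section \<open>Neighbourhoods of zero in a concentrated algebra\<close>

text \<open>\<open>U n\<close> plays the role of the elements below some value of the choice function on an antichain
  of size at least \<open>2 ^ n\<close>.\<close>

locale concentrated_algebra = algebra \<Omega> M for \<Omega> :: "'a set" and M +
  fixes U :: "nat \<Rightarrow> 'a set set"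
  assumes U_sets: "U n \<subseteq> M"
    and U_empty: "{} \<in> U n"
    and U_down: "a \<in> U n \<Longrightarrow> b \<in> M \<Longrightarrow> b \<subseteq> a \<Longrightarrow> b \<in> U n"
    and U_null: "(\<And>n. s n \<in> U n) \<Longrightarrow> null_seq M s"
    and U_meets: "antichain_in M A \<Longrightarrow> finite A \<Longrightarrow> 2 ^ n \<le> card A \<Longrightarrow> A \<inter> U n \<noteq> {}"
    and weakly_distributive: "weakly_distributive M"
begin

text \<open>A nonempty element lies outside some \<open>U n\<close>, since otherwise its constant
  sequence would be null, and fewer than \<open>2 ^ n\<close> elements of an antichain lie outside
  \<open>U n\<close>. The diagonal property needs this in order to enumerate a partition.\<close>

lemma countable_antichain:
  assumes A: "antichain_in M A"
  shows "countable A"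
proof -
  have "A \<subseteq> (\<Union>n. A - U n)"
  proof
    fix a assume a: "a \<in> A"
    then have "a \<noteq> {}" using A by (auto simp: antichain_in_def)
    then have "\<not> (\<forall>n. a \<in> U n)" using U_null[of "\<lambda>_. a"] null_seq_const by blast
    then show "a \<in> (\<Union>n. A - U n)" using a by blast
  qed
  moreover have "finite (A - U n)" for n
  proof (rule ccontr)
    assume "infinite (A - U n)"
    then obtain S where S: "finite S" "card S = 2 ^ n" "S \<subseteq> A - U n"
      using infinite_arbitrarily_large by blast
    then have "antichain_in M S" using A by (blast intro: antichain_in_subset)
    with U_meets[of S n] S show False by auto
  qed
  then have "countable (\<Union>n. A - U n)" by (intro countable_UN) (auto intro: countable_finite)
  ultimately show ?thesis by (rule countable_subset)
qed

lemmas diagonal = weakly_distributive_diagonal[OF weakly_distributive countable_antichain]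

text \<open>Closing \<open>U n\<close> under increasing limits keeps \<open>U_null\<close>, by the diagonal property, and gains that
  every null sequence enters \<open>V n\<close>. So \<open>V\<close> behaves like a neighbourhood base of zero.\<close>

definition V :: "nat \<Rightarrow> 'a set set" where
  "V n = {a \<in> M. \<exists>s. range s \<subseteq> U n \<and> incseq s \<and> (\<forall>k. s k \<subseteq> a) \<and> vanishing M (\<lambda>k. a - s k)}"

lemma VI:
  assumes "a \<in> M" "\<And>k. s k \<in> U n" "incseq s" "\<And>k. s k \<subseteq> a" "vanishing M (\<lambda>k. a - s k)"
  shows "a \<in> V n"
  unfolding V_def using assms by (auto intro!: exI[of _ s])

lemma V_sets: "V n \<subseteq> M" by (auto simp: V_def)

lemma U_subset_V: "U n \<subseteq> V n"
proof
  fix a assume "a \<in> U n"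
  then show "a \<in> V n"
    unfolding V_def using U_sets
    by (auto simp: vanishing_def incseq_def intro!: exI[of _ "\<lambda>_. a"])
qed

lemma V_down:
  assumes "a \<in> V n" "b \<in> M" "b \<subseteq> a"
  shows "b \<in> V n"
proof -
  obtain s where s: "range s \<subseteq> U n" "incseq s" "\<And>k. s k \<subseteq> a" "vanishing M (\<lambda>k. a - s k)"
    using assms(1) unfolding V_def by blast
  have sU: "s k \<in> U n" for k using s(1) by blast
  then have "s k \<inter> b \<in> U n" for k
    using U_sets assms(2) by (intro U_down[OF sU]) auto
  moreover have "incseq (\<lambda>k. s k \<inter> b)" using s(2) unfolding incseq_def by blast
  moreover have "vanishing M (\<lambda>k. b - s k \<inter> b)"
    using s(4) assms(3) unfolding vanishing_def by blast
  ultimately show ?thesis using assms(2,3) s(3) by (intro VI[of _ "\<lambda>k. s k \<inter> b"]) auto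
qed

text \<open>Each \<open>a n\<close> is the union of an approximant in \<open>U n\<close> and an
  error. The approximants form a null sequence by \<open>U_null\<close>, whichever are chosen; the
  diagonal property chooses them so that the errors do too.\<close>

lemma V_null:
  assumes a: "\<And>n. a n \<in> V n"
  shows "null_seq M a"
proof -
  have "\<exists>s. range s \<subseteq> U n \<and> incseq s \<and> (\<forall>k. s k \<subseteq> a n) \<and> vanishing M (\<lambda>k. a n - s k)" for n
    using a[of n] unfolding V_def by blast
  then obtain s where s: "\<And>n. range (s n) \<subseteq> U n" "\<And>n. incseq (s n)"
    "\<And>n k. s n k \<subseteq> a n" "\<And>n. vanishing M (\<lambda>k. a n - s n k)"
    by metis
  have aM: "a n \<in> M" for n using a V_sets by blast
  have sM: "s n k \<in> M" for n k using s(1) U_sets by blast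
  obtain g where g: "null_seq M (\<lambda>n. a n - s n (g n))"
  proof (rule diagonal[of "\<lambda>n k. a n - s n k"])
    show "range (\<lambda>k. a n - s n k) \<subseteq> M" for n using aM sM by auto
    show "decseq (\<lambda>k. a n - s n k)" for n
      using s(2)[of n] unfolding decseq_def incseq_def by blast
  qed (use s(4) in auto)
  have "null_seq M (\<lambda>n. s n (g n))" using s(1) by (intro U_null) blast
  with g have "null_seq M (\<lambda>n. (a n - s n (g n)) \<union> s n (g n))" by (rule null_seq_Un)
  then show ?thesis by (rule null_seq_mono) (use aM in auto)
qed

text \<open>Otherwise every difference \<open>d k - d l\<close> with \<open>l\<close> large avoids \<open>U n\<close>, which gives an infinite
  antichain outside \<open>U n\<close>.\<close>

lemma null_seq_meets_V:
  assumes "null_seq M x"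
  shows "\<exists>k. x k \<in> V n"
proof (rule ccontr)
  assume "\<not> ?thesis"
  then have x: "x k \<notin> V n" for k by blast
  obtain d where d: "range d \<subseteq> M" "decseq d" "vanishing M d" "\<And>k. x k \<subseteq> d k"
    using assms unfolding null_seq_def by blast
  have dM: "d k \<in> M" for k using d(1) by blast
  have xM: "x k \<in> M" for k using assms by (auto simp: null_seq_def)
  have "\<exists>l>k. d k - d l \<notin> U n" for k
  proof (rule ccontr)
    assume "\<not> ?thesis"
    then have U: "d k - d l \<in> U n" if "k < l" for l using that by blast
    \<comment> \<open>For \<open>l \<le> k\<close> the difference is empty. The differences thus all
      lie in \<open>U n\<close> and increase to \<open>d k\<close> in the sense of \<open>V\<close>,
      which puts \<open>d k\<close>, and with it \<open>x k\<close>, into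
      \<open>V n\<close>.\<close>
    have "d k - d l \<in> U n" for l
    proof (cases "k < l")
      case False
      then have "d k - d l = {}" using decseqD[OF d(2), of l k] by auto
      then show ?thesis using U_empty[of n] by metis
    qed (rule U)
    moreover have "incseq (\<lambda>l. d k - d l)" using d(2) unfolding decseq_def incseq_def by blast
    moreover have "vanishing M (\<lambda>l. d k - (d k - d l))"
      using d(3) unfolding vanishing_def by blast
    ultimately have "d k \<in> V n" by (intro VI[of _ "\<lambda>l. d k - d l"] dM) auto
    then show False using V_down[OF _ xM d(4)] x by blast
  qed
  then obtain l where l: "\<And>k. k < l k" "\<And>k. d k - d (l k) \<notin> U n" by metis
  define i where "i m = (l ^^ m) 0" for m
  define e where "e m = d (i m) - d (i (Suc m))" for m
  have iS: "i (Suc m) = l (i m)" for m by (simp add: i_def)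
  have imono: "i m \<le> i m'" if "m \<le> m'" for m m'
    using that by (rule lift_Suc_mono_le[rotated]) (use l(1) iS in \<open>simp add: less_imp_le\<close>)
  have e: "e m \<notin> U n" "e m \<in> M" for m
    using l(2)[of "i m"] dM by (auto simp: e_def iS)
  then have e0: "e m \<noteq> {}" for m using U_empty[of n] by metis
  have step: "e m \<inter> e m' = {}" if "m < m'" for m m'
    using decseqD[OF d(2) imono[of "Suc m" m']] that by (auto simp: e_def)
  then have dj: "e m \<inter> e m' = {}" if "m \<noteq> m'" for m m'
    using that step by (metis linorder_neqE_nat Int_commute)
  have "inj_on e {..<2 ^ n}"
    using dj e0 unfolding inj_on_def by (metis Int_absorb)
  then have "card (e ` {..<2 ^ n}) = 2 ^ n" by (simp add: card_image)
  moreover have "antichain_in M (e ` {..<2 ^ n})"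
    unfolding antichain_in_def
  proof (intro conjI ballI impI)
    fix a b assume "a \<in> e ` {..<2 ^ n}" "b \<in> e ` {..<2 ^ n}" "a \<noteq> b"
    then show "a \<inter> b = {}" using dj by (metis imageE)
  qed (use e(2) e0 in auto)
  ultimately have "e ` {..<2 ^ n} \<inter> U n \<noteq> {}" by (intro U_meets) auto
  then show False using e(1) by blast
qed

text \<open>Counterexamples for all \<open>m\<close> form \<open>Q\<close> null sequences by
  \<open>V_null\<close>. Their union is a null sequence that avoids \<open>V n\<close>, against
  \<open>null_seq_meets_V\<close>.\<close>

lemma V_absorbs_unions:
  "\<exists>m. \<forall>a. (\<forall>q<Q. a q \<in> V m) \<longrightarrow> (\<Union>q<Q::nat. a q) \<in> V n"
proof (rule ccontr)
  assume "\<not> ?thesis"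
  then obtain a where a: "\<And>m q. q < Q \<Longrightarrow> a m q \<in> V m" "\<And>m. (\<Union>q<Q. a m q) \<notin> V n" by metis
  have "null_seq M (\<lambda>m. \<Union>q<Q. a m q)"
    by (intro null_seq_finite_UN V_null a(1))
  with null_seq_meets_V a(2) show False by blast
qed

text \<open>The reciprocal of \<open>K\<close> bounds Kelley's intersection number from below. Four
  is the degree of the expander, and \<open>2 ^ m\<close> is the antichain bound outside
  \<open>V m\<close> that enters \<open>kalton_roberts\<close> as \<open>r\<close>.\<close>

lemma positive_intersection_number:
  "\<exists>K. \<forall>N c. (\<forall>i<N. c i \<in> M - V n) \<longrightarrow> 0 < N \<longrightarrow> (\<exists>x\<in>\<Omega>. N \<le> K * card {i. i < N \<and> x \<in> c i})"
proof -
  obtain m where m: "\<And>a. (\<forall>q<4. a q \<in> V m) \<Longrightarrow> (\<Union>q<4::nat. a q) \<in> V n"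
    using V_absorbs_unions[of 4 n] by blast
  have "\<exists>x\<in>\<Omega>. N \<le> 900 * (2 ^ m)\<^sup>2 * card {i. i < N \<and> x \<in> c i}"
    if "\<forall>i<N. c i \<in> M - V n" "0 < N" for N c
  proof (rule kalton_roberts[where C = "M - V n" and D = "M - V m"])
    show "\<exists>q<4. a q \<in> M - V m" if "\<And>q. q < 4 \<Longrightarrow> a q \<in> M" "(\<Union>q<4::nat. a q) \<in> M - V n" for a
      using m[of a] that by blast
    show "{} \<notin> M - V m" using U_empty U_subset_V by blast
    fix A assume A: "antichain_in M A" "finite A" "A \<subseteq> M - V m"
    show "card A \<le> 2 ^ m"
    proof (rule ccontr)
      assume "\<not> ?thesis"
      then have "A \<inter> U m \<noteq> {}" using A by (intro U_meets) auto
      then show False using A(3) U_subset_V by blast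
    qed
  qed (use that in auto)
  then show ?thesis by blast
qed

lemma Inter_V: "(\<And>n. a \<in> V n) \<Longrightarrow> a = {}"
  using V_null[of "\<lambda>_. a"] null_seq_const by blast

end

section \<open>Finitely additive measures\<close>

text \<open>Real weights are reduced to multiplicities by rounding \<open>n * t\<close> down for large \<open>n\<close>.\<close>

lemma weighted_intersection_bound:
  fixes \<delta> s :: real and ts :: "(real \<times> 'a set) list"
  assumes "\<Omega> \<noteq> {}" "0 \<le> \<delta>"
    and hit: "\<And>N c. (\<forall>i<N. c i \<in> C) \<Longrightarrow> 0 < N \<Longrightarrow> \<exists>x\<in>\<Omega>. \<delta> * real N \<le> real (card {i. i < N \<and> x \<in> c i})"
    and ts: "set ts \<subseteq> {0..} \<times> C"
    and s: "\<And>x. x \<in> \<Omega> \<Longrightarrow> (\<Sum>(t, c)\<leftarrow>ts. t * (indicator c x - \<delta>)) \<le> s"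
  shows "0 \<le> s"
proof (rule ccontr)
  assume "\<not> 0 \<le> s"
  \<comment> \<open>Rounding loses at most one copy per list entry, so \<open>n\<close> is chosen to
    make the gain \<open>n * (- s)\<close> exceed \<open>\<delta>\<close> times the number of
    entries.\<close>
  then obtain n where n: "\<delta> * length ts < real n * (- s)"
    using reals_Archimedean3[of "- s"] by auto
  define L where "L ts = concat (map (\<lambda>(t, c). replicate (nat \<lfloor>real n * t\<rfloor>) c) ts)" for ts :: "(real \<times> 'a set) list"
  have L: "set (L ts) \<subseteq> C" using ts by (auto simp: L_def)
  have len: "real n * (\<Sum>(t, c)\<leftarrow>ts. t) - length ts \<le> length (L ts)"
    using ts
  proof (induction ts)
    case (Cons p ts)
    obtain t c where p: "p = (t, c)" by fastforce
    have "real n * t - 1 \<le> nat \<lfloor>real n * t\<rfloor>" by linarith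
    then show ?case using Cons by (simp add: L_def p algebra_simps)
  qed (simp add: L_def)
  have filter: "length (filter (\<lambda>c. x \<in> c) (L ts)) \<le> real n * (\<Sum>(t, c)\<leftarrow>ts. t * indicator c x)" for x
    using ts
  proof (induction ts)
    case (Cons p ts)
    obtain t c where p: "p = (t, c)" by fastforce
    have "0 \<le> real n * t" using Cons.prems p by simp
    define k where "k = nat \<lfloor>real n * t\<rfloor>"
    have k: "real k \<le> real n * t" using \<open>0 \<le> real n * t\<close> unfolding k_def by linarith
    have "L (p # ts) = replicate k c @ L ts" by (simp add: L_def p k_def)
    then show ?case using Cons k by (cases "x \<in> c") (simp_all add: p distrib_left)
  qed (simp add: L_def)
  have "\<exists>x\<in>\<Omega>. \<delta> * length (L ts) \<le> real (length (filter (\<lambda>c. x \<in> c) (L ts)))"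
  proof (cases "L ts = []")
    case False
    then show ?thesis
      using hit[of "length (L ts)" "nth (L ts)"] L nth_mem
      by (auto simp: length_filter_conv_card)
  qed (use \<open>\<Omega> \<noteq> {}\<close> in auto)
  then obtain x where x: "x \<in> \<Omega>" "\<delta> * length (L ts) \<le> length (filter (\<lambda>c. x \<in> c) (L ts))" by blast
  have "\<delta> * (real n * (\<Sum>(t, c)\<leftarrow>ts. t) - length ts) \<le> \<delta> * length (L ts)"
    using len \<open>0 \<le> \<delta>\<close> by (rule mult_left_mono)
  also note x(2)
  also note filter[of x]
  finally have "real n * ((\<Sum>(t, c)\<leftarrow>ts. t * indicator c x) - \<delta> * (\<Sum>(t, c)\<leftarrow>ts. t)) \<ge> - (\<delta> * length ts)"
    by (simp add: algebra_simps)
  also have "(\<Sum>(t, c)\<leftarrow>ts. t * indicator c x) - \<delta> * (\<Sum>(t, c)\<leftarrow>ts. t)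
      = (\<Sum>(t, c)\<leftarrow>ts. t * (indicator c x - \<delta>))"
    by (induction ts) (auto simp: algebra_simps)
  finally have "- (\<delta> * length ts) \<le> real n * (\<Sum>(t, c)\<leftarrow>ts. t * (indicator c x - \<delta>))" .
  also have "\<dots> \<le> real n * s" using s[OF x(1)] by (rule mult_left_mono) simp
  finally show False using n by simp
qed

text \<open>On a discrete space every function is continuous, so this type consists of all bounded
  functions and brings the vector space structure and the supremum norm.\<close>

definition bounded_indicator :: "'a set \<Rightarrow> 'a discrete \<Rightarrow>\<^sub>C real" where
  "bounded_indicator a = Bcontfun (\<lambda>x. indicator a (of_discrete x))"

lemma bounded_indicator_apply: "bounded_indicator a (discrete x) = indicator a x"
proof -
  have "(\<lambda>x. indicator a (of_discrete x) :: real) \<in> bcontfun"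
    by (rule bcontfun_normI[where b = 1])
      (auto simp: indicator_def continuous_on_open_vimage open_discrete)
  then show ?thesis
    by (simp add: bounded_indicator_def Bcontfun_inverse discrete_inverse)
qed

text \<open>Kelley's theorem, by a Hahn-Banach argument on bounded functions: \<open>q f\<close> is the least upper
  bound of \<open>f + g\<close> that can be achieved with \<open>g\<close> in the cone generated by the functions
  \<open>indicator c - \<delta>\<close>. A linear \<open>L \<le> q\<close> satisfies \<open>L (indicator c) \<ge> \<delta>\<close>.\<close>

lemma (in algebra) kelley:
  fixes \<delta> :: real
  assumes "\<Omega> \<noteq> {}" "0 \<le> \<delta>"
    and hit: "\<And>N c. (\<forall>i<N. c i \<in> C) \<Longrightarrow> 0 < N \<Longrightarrow> \<exists>x\<in>\<Omega>. \<delta> * real N \<le> real (card {i. i < N \<and> x \<in> c i})"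
  obtains \<mu> :: "'a set \<Rightarrow> real" where "additive M \<mu>" "\<And>a. 0 \<le> \<mu> a" "\<mu> \<Omega> = 1" "\<And>c. c \<in> C \<Longrightarrow> \<delta> \<le> \<mu> c"
proof -
  define cone where "cone ts x = (\<Sum>(t, c)\<leftarrow>ts. t * (indicator c x - \<delta>))"
    for ts :: "(real \<times> 'a set) list" and x
  define Q where "Q f = {s. \<exists>ts. set ts \<subseteq> {0..} \<times> C \<and> (\<forall>x\<in>\<Omega>. f (discrete x) + cone ts x \<le> s)}"
    for f :: "'a discrete \<Rightarrow>\<^sub>C real"
  define q where "q f = Inf (Q f)" for f
  have QI: "s \<in> Q f" if "\<And>x. x \<in> \<Omega> \<Longrightarrow> f (discrete x) \<le> s"
    for s and f :: "'a discrete \<Rightarrow>\<^sub>C real"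
    unfolding Q_def using that by (auto intro!: exI[of _ "[]"] simp: cone_def)
  have norm: "- norm f \<le> f x" "f x \<le> norm f" for f :: "'a discrete \<Rightarrow>\<^sub>C real" and x
    using norm_bounded[of f x] by (auto simp: abs_le_iff)
  \<comment> \<open>This keeps \<open>q\<close> finite, and it is where \<open>hit\<close> enters: a
    constant that bounds a cone element above on \<open>\<Omega>\<close> cannot be negative.\<close>
  have lower: "- norm f \<le> s" if sQ: "s \<in> Q f" for s and f :: "'a discrete \<Rightarrow>\<^sub>C real"
  proof -
    obtain ts where ts: "set ts \<subseteq> {0..} \<times> C" "\<And>x. x \<in> \<Omega> \<Longrightarrow> f (discrete x) + cone ts x \<le> s"
      using sQ unfolding Q_def by blast
    have "cone ts x \<le> s + norm f" if "x \<in> \<Omega>" for x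
      using ts(2)[OF that] norm(1)[of f "discrete x"] by linarith
    then have "0 \<le> s + norm f"
      unfolding cone_def by (intro weighted_intersection_bound[OF assms(1,2) _ ts(1)] hit)
    then show ?thesis by simp
  qed
  have ne: "Q f \<noteq> {}" for f using QI[of f "norm f"] norm(2) by blast
  have bdd: "bdd_below (Q f)" for f using lower by (rule bdd_belowI)
  have q_le: "q f \<le> s" if "s \<in> Q f" for f :: "'a discrete \<Rightarrow>\<^sub>C real" and s
    unfolding q_def using that bdd by (rule cInf_lower)
  have le_q: "s \<le> q f" if "\<And>s'. s' \<in> Q f \<Longrightarrow> s \<le> s'" for f :: "'a discrete \<Rightarrow>\<^sub>C real" and s
    unfolding q_def using ne that by (rule cInf_greatest)
  have "sublinear q"
  proof (rule sublinearI)
    fix f g :: "'a discrete \<Rightarrow>\<^sub>C real"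
    have sum: "q (f + g) \<le> s + s'" if "s \<in> Q f" "s' \<in> Q g" for s s'
    proof (rule q_le)
      obtain ts where ts: "set ts \<subseteq> {0..} \<times> C" "\<forall>x\<in>\<Omega>. f (discrete x) + cone ts x \<le> s"
        using \<open>s \<in> Q f\<close> unfolding Q_def by blast
      obtain ts' where ts': "set ts' \<subseteq> {0..} \<times> C" "\<forall>x\<in>\<Omega>. g (discrete x) + cone ts' x \<le> s'"
        using \<open>s' \<in> Q g\<close> unfolding Q_def by blast
      have "(f + g) (discrete x) + cone (ts @ ts') x \<le> s + s'" if "x \<in> \<Omega>" for x
        using bspec[OF ts(2) that] bspec[OF ts'(2) that] by (simp add: cone_def)
      then show "s + s' \<in> Q (f + g)"
        unfolding Q_def using ts(1) ts'(1) by (auto intro!: exI[of _ "ts @ ts'"])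
    qed
    have "q (f + g) - q g \<le> s" if "s \<in> Q f" for s
    proof -
      have "q (f + g) - s \<le> q g" using sum[OF that] by (intro le_q) (simp add: algebra_simps)
      then show ?thesis by simp
    qed
    then have "q (f + g) - q g \<le> q f" by (rule le_q)
    then show "q (f + g) \<le> q f + q g" by simp
  next
    have "q 0 \<le> 0" by (intro q_le QI) simp
    moreover have "0 \<le> q 0" using lower[of _ 0] by (intro le_q) simp
    ultimately show "q 0 = 0" by simp
  next
    fix r :: real and f :: "'a discrete \<Rightarrow>\<^sub>C real" assume r: "0 < r"
    have "q (r *\<^sub>R f) / r \<le> s" if sQ: "s \<in> Q f" for s
    proof -
      obtain ts where ts: "set ts \<subseteq> {0..} \<times> C" "\<forall>x\<in>\<Omega>. f (discrete x) + cone ts x \<le> s"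
        using sQ unfolding Q_def by blast
      let ?ts = "map (\<lambda>(t, c). (r * t, c)) ts"
      have "cone ?ts x = r * cone ts x" for x
        unfolding cone_def by (induction ts) (auto simp: algebra_simps)
      then have "(r *\<^sub>R f) (discrete x) + cone ?ts x \<le> r * s" if "x \<in> \<Omega>" for x
        using mult_left_mono[OF bspec[OF ts(2) that], of r] r by (simp add: algebra_simps)
      moreover have "set ?ts \<subseteq> {0..} \<times> C" using ts(1) r by auto
      ultimately have "r * s \<in> Q (r *\<^sub>R f)" unfolding Q_def by blast
      then have "q (r *\<^sub>R f) \<le> r * s" by (rule q_le)
      then show ?thesis using r by (simp add: divide_le_eq mult.commute)
    qed
    then have "q (r *\<^sub>R f) / r \<le> q f" by (rule le_q)
    then show "q (r *\<^sub>R f) \<le> r * q f" using r by (simp add: divide_le_eq mult.commute)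
  qed
  then obtain L where L: "linear L" "\<And>f. L f \<le> q f" by (rule sublinear_dominates_linear) blast
  have L_neg: "- s \<le> L f" if "s \<in> Q (- f)" for f s
    using L(2)[of "- f"] q_le[OF that] linear_neg[OF L(1), of f] by simp
  show thesis
  proof (rule that[of "\<lambda>a. L (bounded_indicator a)"])
    show "additive M (\<lambda>a. L (bounded_indicator a))"
      unfolding additive_def
    proof (intro ballI impI)
      fix a b :: "'a set" assume "a \<inter> b = {}"
      then have "bounded_indicator (a \<union> b) x = (bounded_indicator a + bounded_indicator b) x" for x
        by (cases x) (auto simp: bounded_indicator_apply indicator_def)
      then have "bounded_indicator (a \<union> b) = bounded_indicator a + bounded_indicator b"
        by (rule bcontfun_eqI)
      then show "L (bounded_indicator (a \<union> b)) = L (bounded_indicator a) + L (bounded_indicator b)"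
        using linear_add[OF L(1)] by simp
    qed
    show "0 \<le> L (bounded_indicator a)" for a
      using L_neg[of 0 "bounded_indicator a"] QI[of "- bounded_indicator a" 0]
      by (simp add: bounded_indicator_apply)
    show "L (bounded_indicator \<Omega>) = 1"
    proof (rule antisym)
      show "L (bounded_indicator \<Omega>) \<le> 1"
        using L(2)[of "bounded_indicator \<Omega>"] q_le[OF QI[of "bounded_indicator \<Omega>" 1]]
        by (simp add: bounded_indicator_apply)
      show "1 \<le> L (bounded_indicator \<Omega>)"
        using L_neg[of "- 1" "bounded_indicator \<Omega>"] QI[of "- bounded_indicator \<Omega>" "- 1"]
        by (simp add: bounded_indicator_apply)
    qed
    fix c assume "c \<in> C"
    \<comment> \<open>The single generator of \<open>c\<close> with weight 1 cancels
      \<open>- indicator c\<close> and leaves the constant \<open>- \<delta>\<close>.\<close>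
    have "- \<delta> \<in> Q (- bounded_indicator c)"
      unfolding Q_def
    proof (intro CollectI exI[of _ "[(1, c)]"] conjI ballI)
      show "set [(1::real, c)] \<subseteq> {0..} \<times> C" using \<open>c \<in> C\<close> by simp
      show "(- bounded_indicator c) (discrete x) + cone [(1, c)] x \<le> - \<delta>" for x
        by (simp add: cone_def bounded_indicator_apply)
    qed
    then show "\<delta> \<le> L (bounded_indicator c)" using L_neg by fastforce
  qed
qed

text \<open>By \<open>Inter_V\<close> a nonempty \<open>a\<close> lies outside some
  \<open>V n\<close>, and the term of that index alone makes the weighted sum positive.\<close>

lemma (in concentrated_algebra) strictly_positive_charge:
  assumes ne: "\<Omega> \<noteq> {}"
  obtains \<mu> :: "'a set \<Rightarrow> real" where "additive M \<mu>" "\<And>a. 0 \<le> \<mu> a" "\<And>a. a \<in> M \<Longrightarrow> \<mu> a = 0 \<Longrightarrow> a = {}"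
proof -
  have "\<exists>(\<nu> :: 'a set \<Rightarrow> real) \<delta>. additive M \<nu> \<and> (\<forall>a. 0 \<le> \<nu> a) \<and> \<nu> \<Omega> = 1 \<and> 0 < \<delta> \<and> (\<forall>c\<in>M - V n. \<delta> \<le> \<nu> c)"
    for n
  proof -
    obtain K where K: "\<And>N c. (\<forall>i<N. c i \<in> M - V n) \<Longrightarrow> 0 < N \<Longrightarrow>
        \<exists>x\<in>\<Omega>. N \<le> K * card {i. i < N \<and> x \<in> c i}"
      using positive_intersection_number[of n] by metis
    \<comment> \<open>Adding 1 keeps \<open>\<delta>\<close> positive even for
      \<open>K = 0\<close>.\<close>
    define \<delta> where "\<delta> = 1 / (real K + 1)"
    have hit: "\<exists>x\<in>\<Omega>. \<delta> * real N \<le> real (card {i. i < N \<and> x \<in> c i})"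
      if c: "\<forall>i<N. c i \<in> M - V n" "0 < N" for N c
    proof -
      obtain x where x: "x \<in> \<Omega>" "N \<le> K * card {i. i < N \<and> x \<in> c i}" using K[OF c] by blast
      then have "real N \<le> real K * real (card {i. i < N \<and> x \<in> c i})"
        by (simp flip: of_nat_mult)
      also have "\<dots> \<le> (real K + 1) * real (card {i. i < N \<and> x \<in> c i})"
        by (intro mult_right_mono) auto
      finally have "\<delta> * real N \<le> real (card {i. i < N \<and> x \<in> c i})"
        by (simp add: \<delta>_def divide_le_eq mult.commute)
      with x(1) show ?thesis by blast
    qed
    have "0 < \<delta>" by (simp add: \<delta>_def)
    show ?thesis
    proof (rule kelley[where C = "M - V n" and \<delta> = \<delta>])
      fix \<nu> :: "'a set \<Rightarrow> real"
      assume "additive M \<nu>" "\<And>a. 0 \<le> \<nu> a" "\<nu> \<Omega> = 1" "\<And>c. c \<in> M - V n \<Longrightarrow> \<delta> \<le> \<nu> c"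
      with \<open>0 < \<delta>\<close> show ?thesis by (intro exI[of _ \<nu>] exI[of _ \<delta>] conjI ballI allI) auto
    qed (use ne \<open>0 < \<delta>\<close> hit in auto)
  qed
  then obtain \<nu> \<delta> where \<nu>: "\<And>n. additive M (\<nu> n)" "\<And>n a. (0::real) \<le> \<nu> n a" "\<And>n. \<nu> n \<Omega> = 1"
    "\<And>n. (0::real) < \<delta> n" "\<And>n c. c \<in> M - V n \<Longrightarrow> \<delta> n \<le> \<nu> n c"
    by metis
  have le1: "\<nu> n a \<le> 1" if "a \<in> M" for n a
  proof -
    have "\<nu> n (a \<union> (\<Omega> - a)) = \<nu> n a + \<nu> n (\<Omega> - a)"
      using that by (intro additiveD[OF \<nu>(1)]) auto
    moreover have "a \<union> (\<Omega> - a) = \<Omega>" using that sets_into_space by blast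
    ultimately show ?thesis using \<nu>(2)[of n "\<Omega> - a"] \<nu>(3)[of n] by simp
  qed
  define \<mu> where "\<mu> a = (\<Sum>n. (1 / 2) ^ n * \<nu> n a)" for a
  have summ: "summable (\<lambda>n. (1 / 2) ^ n * \<nu> n a)" if "a \<in> M" for a
  proof (rule summable_comparison_test')
    show "summable (\<lambda>n. (1 / 2 :: real) ^ n)" by (simp add: summable_geometric)
    show "norm ((1 / 2) ^ n * \<nu> n a) \<le> (1 / 2) ^ n" if "0 \<le> n" for n
      using le1[OF \<open>a \<in> M\<close>, of n] \<nu>(2)[of n a] by (simp add: abs_mult)
  qed
  show thesis
  \<comment> \<open>Convergence of the series is known only on \<open>M\<close>; the default 0
    secures nonnegativity for all other sets.\<close>
  proof (rule that[of "\<lambda>a. if a \<in> M then \<mu> a else 0"])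
    show "additive M (\<lambda>a. if a \<in> M then \<mu> a else 0)"
      unfolding additive_def
    proof (intro ballI impI)
      fix a b assume ab: "a \<in> M" "b \<in> M" "a \<inter> b = {}"
      have "\<mu> (a \<union> b) = (\<Sum>n. (1 / 2) ^ n * \<nu> n a + (1 / 2) ^ n * \<nu> n b)"
        unfolding \<mu>_def using additiveD[OF \<nu>(1) ab(3,1,2)] by (simp add: distrib_left)
      also have "\<dots> = \<mu> a + \<mu> b"
        unfolding \<mu>_def using summ ab by (intro suminf_add[symmetric]) auto
      finally show "(if a \<union> b \<in> M then \<mu> (a \<union> b) else 0) =
          (if a \<in> M then \<mu> a else 0) + (if b \<in> M then \<mu> b else 0)"
        using ab by auto
    qed
    show "0 \<le> (if a \<in> M then \<mu> a else 0)" for a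
      using \<nu>(2) summ by (auto simp: \<mu>_def intro!: suminf_nonneg)
    fix a assume a: "a \<in> M" "(if a \<in> M then \<mu> a else 0) = 0"
    show "a = {}"
    proof (rule Inter_V, rule ccontr)
      fix n assume "a \<notin> V n"
      then have "0 < (1 / 2) ^ n * \<nu> n a" using \<nu>(4)[of n] \<nu>(5)[of a n] a(1) by auto
      then have "0 < \<mu> a"
        unfolding \<mu>_def using summ[OF a(1)] \<nu>(2) by (intro suminf_pos2) auto
      then show False using a by simp
    qed
  qed
qed

lemma suminf_ennreal_swap:
  fixes f :: "nat \<Rightarrow> nat \<Rightarrow> ennreal"
  shows "(\<Sum>n. \<Sum>k. f n k) = (\<Sum>k. \<Sum>n. f n k)"
  using nn_integral_suminf[of "\<lambda>k n. f n k" "count_space UNIV"]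
  by (simp add: nn_integral_count_space_nat)

section \<open>The countably additive part of a finitely additive measure\<close>

context algebra
begin

text \<open>The order form of "\<open>a\<close> lies below the supremum of the \<open>p k\<close>":
  it agrees with this when the supremum exists, and the union of the \<open>p k\<close> need not
  contain \<open>a\<close>.\<close>

definition covers :: "'a set \<Rightarrow> (nat \<Rightarrow> 'a set) set" where
  "covers a = {p. range p \<subseteq> M \<and> (\<forall>b\<in>M. b \<subseteq> a \<longrightarrow> (\<forall>k. b \<inter> p k = {}) \<longrightarrow> b = {})}"

text \<open>The largest countably additive measure below a finitely additive \<open>\<mu>\<close>. Covers need not be
  disjoint, as in the construction of an outer measure.\<close>

definition sigma_hull :: "('a set \<Rightarrow> real) \<Rightarrow> 'a set \<Rightarrow> ennreal" where
  "sigma_hull \<mu> a = (INF p\<in>covers a. \<Sum>k. ennreal (\<mu> (p k)))"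

lemma coversI:
  assumes "\<And>k. p k \<in> M" "\<And>b. b \<in> M \<Longrightarrow> b \<subseteq> a \<Longrightarrow> (\<And>k. b \<inter> p k = {}) \<Longrightarrow> b = {}"
  shows "p \<in> covers a"
  using assms unfolding covers_def by blast

lemma coversD:
  assumes "p \<in> covers a"
  shows "p k \<in> M" and "b \<in> M \<Longrightarrow> b \<subseteq> a \<Longrightarrow> (\<And>k. b \<inter> p k = {}) \<Longrightarrow> b = {}"
  using assms unfolding covers_def by auto

lemma sigma_hull_le: "p \<in> covers a \<Longrightarrow> sigma_hull \<mu> a \<le> (\<Sum>k. ennreal (\<mu> (p k)))"
  unfolding sigma_hull_def by (rule INF_lower)

context
  fixes \<mu> :: "'a set \<Rightarrow> real"
  assumes add: "additive M \<mu>" and nonneg: "\<And>a. a \<in> M \<Longrightarrow> 0 \<le> \<mu> a"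
begin

lemma charge_empty: "\<mu> {} = 0"
  using additiveD[OF add, of "{}" "{}"] by simp

lemma charge_mono: "a \<in> M \<Longrightarrow> b \<in> M \<Longrightarrow> a \<subseteq> b \<Longrightarrow> \<mu> a \<le> \<mu> b"
  using additiveD[OF add, of a "b - a"] nonneg[of "b - a"] by (simp add: Diff Un_absorb1)

lemma charge_finite_UN:
  assumes "finite I" "\<And>i. i \<in> I \<Longrightarrow> a i \<in> M"
  shows "\<mu> (\<Union>i\<in>I. a i) \<le> (\<Sum>i\<in>I. \<mu> (a i))"
  using assms
proof (induction I)
  case (insert i I)
  let ?u = "\<Union>i\<in>I. a i"
  have u: "?u \<in> M" "a i \<in> M" using insert by auto
  have "\<mu> (?u \<union> (a i - ?u)) = \<mu> ?u + \<mu> (a i - ?u)"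
    using u by (intro additiveD[OF add]) auto
  moreover have "\<mu> (a i - ?u) \<le> \<mu> (a i)" using u by (intro charge_mono) auto
  moreover have "?u \<union> (a i - ?u) = (\<Union>i\<in>insert i I. a i)" by auto
  ultimately show ?case using insert by simp
qed (simp add: charge_empty)

lemma charge_disjoint_sum:
  assumes "finite I" "\<And>i. i \<in> I \<Longrightarrow> a i \<in> M" "disjoint_family_on a I"
  shows "\<mu> (\<Union>i\<in>I. a i) = (\<Sum>i\<in>I. \<mu> (a i))"
  using assms
proof (induction I)
  case (insert i I)
  have "\<mu> (a i \<union> (\<Union>i\<in>I. a i)) = \<mu> (a i) + \<mu> (\<Union>i\<in>I. a i)"
    using insert by (intro additiveD[OF add]) (auto simp: disjoint_family_on_def)
  moreover have "disjoint_family_on a I"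
    using insert.prems by (auto simp: disjoint_family_on_def)
  ultimately show ?case using insert by simp
qed (simp add: charge_empty)

lemma charge_disjoint_suminf:
  assumes a: "\<And>n. a n \<in> M" "disjoint_family a" and p: "p \<in> M"
  shows "(\<Sum>n. ennreal (\<mu> (p \<inter> a n))) \<le> ennreal (\<mu> p)"
proof (rule suminf_le_const[OF summableI])
  fix n
  have "(\<Sum>i<n. \<mu> (p \<inter> a i)) = \<mu> (\<Union>i<n. p \<inter> a i)"
    using a p by (intro charge_disjoint_sum[symmetric]) (auto simp: disjoint_family_on_def)
  also have "\<dots> \<le> \<mu> p" using a p by (intro charge_mono) auto
  finally show "(\<Sum>i<n. ennreal (\<mu> (p \<inter> a i))) \<le> ennreal (\<mu> p)"
    using a p by (subst sum_ennreal) (auto intro!: nonneg ennreal_leI)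
qed

lemma sigma_hull_le_charge:
  assumes "a \<in> M"
  shows "sigma_hull \<mu> a \<le> ennreal (\<mu> a)"
proof -
  let ?p = "\<lambda>k::nat. if k = 0 then a else {}"
  have "?p \<in> covers a"
  proof (rule coversI)
    fix b assume "b \<in> M" "b \<subseteq> a" and dj: "\<And>k. b \<inter> ?p k = {}"
    from dj[of 0] \<open>b \<subseteq> a\<close> show "b = {}" by auto
  qed (use assms in auto)
  then have "sigma_hull \<mu> a \<le> (\<Sum>k. ennreal (\<mu> (?p k)))" by (rule sigma_hull_le)
  also have "\<dots> = (\<Sum>k\<in>{0}. ennreal (\<mu> (?p k)))"
    by (rule suminf_finite) (auto simp: charge_empty)
  finally show ?thesis by simp
qed

text \<open>A cover of \<open>s\<close> restricts to a cover of each \<open>a n\<close>. After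
  exchanging the sums, finite additivity bounds the total mass of the disjoint pieces of a single
  \<open>p k\<close> by \<open>\<mu> (p k)\<close>.\<close>

lemma sigma_hull_superadditive:
  assumes a: "\<And>n. a n \<in> M" "disjoint_family a" "\<And>n. a n \<subseteq> s" and "s \<in> M"
  shows "(\<Sum>n. sigma_hull \<mu> (a n)) \<le> sigma_hull \<mu> s"
  unfolding sigma_hull_def[of \<mu> s]
proof (rule INF_greatest)
  fix p assume p: "p \<in> covers s"
  note pM = coversD(1)[OF p]
  have "(\<lambda>k. p k \<inter> a n) \<in> covers (a n)" for n
  proof (rule coversI)
    show "p k \<inter> a n \<in> M" for k using pM a(1) by auto
    fix b assume b: "b \<in> M" "b \<subseteq> a n" and dj: "\<And>k. b \<inter> (p k \<inter> a n) = {}"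
    have "b \<inter> p k = {}" for k using dj[of k] b(2) by auto
    moreover have "b \<subseteq> s" using b(2) a(3) by (rule subset_trans)
    ultimately show "b = {}" by (rule coversD(2)[OF p b(1), rotated])
  qed
  then have "sigma_hull \<mu> (a n) \<le> (\<Sum>k. ennreal (\<mu> (p k \<inter> a n)))" for n
    by (rule sigma_hull_le)
  then have "(\<Sum>n. sigma_hull \<mu> (a n)) \<le> (\<Sum>n. \<Sum>k. ennreal (\<mu> (p k \<inter> a n)))"
    by (intro suminf_le summableI) auto
  also have "\<dots> = (\<Sum>k. \<Sum>n. ennreal (\<mu> (p k \<inter> a n)))"
    by (rule suminf_ennreal_swap)
  also have "\<dots> \<le> (\<Sum>k. ennreal (\<mu> (p k)))"
    using a pM by (intro suminf_le summableI charge_disjoint_suminf) auto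
  finally show "(\<Sum>n. sigma_hull \<mu> (a n)) \<le> (\<Sum>k. ennreal (\<mu> (p k)))" .
qed

text \<open>The outer measure argument with errors \<open>e / 2 ^ (n + 1)\<close>. Covers of the
  \<open>a n\<close> combine into one of \<open>s\<close> because an element missing all
  \<open>p n k\<close> has empty trace on every \<open>a n\<close>.\<close>

lemma sigma_hull_subadditive:
  assumes a: "\<And>n. a n \<in> M" and s: "\<And>b. b \<in> M \<Longrightarrow> b \<subseteq> s \<Longrightarrow> (\<And>n. b \<inter> a n = {}) \<Longrightarrow> b = {}"
  shows "sigma_hull \<mu> s \<le> (\<Sum>n. sigma_hull \<mu> (a n))"
proof (rule ennreal_le_epsilon)
  fix e :: real assume e: "0 < e"
  have "\<exists>p\<in>covers (a n). (\<Sum>k. ennreal (\<mu> (p k))) \<le> sigma_hull \<mu> (a n) + ennreal e * ennreal ((1 / 2) ^ Suc n)" for n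
  proof -
    have "sigma_hull \<mu> (a n) < top"
      using sigma_hull_le_charge[OF a, of n] by (rule le_less_trans) simp
    moreover have "0 < ennreal e * ennreal ((1 / 2) ^ Suc n)"
      using e by (simp add: ennreal_zero_less_mult_iff)
    ultimately have "sigma_hull \<mu> (a n) < sigma_hull \<mu> (a n) + ennreal e * ennreal ((1 / 2) ^ Suc n)"
      using ennreal_add_left_cancel_less[of "sigma_hull \<mu> (a n)" 0] by simp
    then show ?thesis
      unfolding sigma_hull_def[of \<mu> "a n"] INF_less_iff by (meson less_imp_le)
  qed
  then obtain p where p: "\<And>n. p n \<in> covers (a n)"
    "\<And>n. (\<Sum>k. ennreal (\<mu> (p n k))) \<le> sigma_hull \<mu> (a n) + ennreal e * ennreal ((1 / 2) ^ Suc n)"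
    by metis
  let ?r = "\<lambda>i. case prod_decode i of (n, k) \<Rightarrow> p n k"
  have "?r \<in> covers s"
  proof (rule coversI)
    show "?r i \<in> M" for i using coversD(1)[OF p(1)] by (simp split: prod.split)
    fix b assume b: "b \<in> M" "b \<subseteq> s" and dj: "\<And>i. b \<inter> ?r i = {}"
    have "b \<inter> p n k = {}" for n k using dj[of "prod_encode (n, k)"] by simp
    then have "b \<inter> a n \<inter> p n k = {}" for n k by blast
    then have "b \<inter> a n = {}" for n
      by (rule coversD(2)[OF p(1)[of n], rotated 2]) (use b(1) a in auto)
    then show "b = {}" by (rule s[OF b])
  qed
  then have "sigma_hull \<mu> s \<le> (\<Sum>i. ennreal (\<mu> (?r i)))" by (rule sigma_hull_le)
  also have "\<dots> = (\<Sum>i. (\<lambda>(n, k). ennreal (\<mu> (p n k))) (prod_decode i))"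
    by (intro arg_cong[where f = suminf]) (auto split: prod.split)
  also have "\<dots> = (\<Sum>n. \<Sum>k. ennreal (\<mu> (p n k)))"
    by (rule suminf_ennreal_2dimen) simp
  also have "\<dots> \<le> (\<Sum>n. sigma_hull \<mu> (a n) + ennreal e * ennreal ((1 / 2) ^ Suc n))"
    by (intro suminf_le summableI p(2))
  also have "\<dots> = (\<Sum>n. sigma_hull \<mu> (a n)) + (\<Sum>n. ennreal e * ennreal ((1 / 2) ^ Suc n))"
    by (intro suminf_add[symmetric] summableI)
  also have "(\<Sum>n. ennreal e * ennreal ((1 / 2) ^ Suc n)) = ennreal e"
    unfolding ennreal_suminf_cmult
    by (subst suminf_ennreal_eq[OF zero_le_power power_half_series]) auto
  finally show "sigma_hull \<mu> s \<le> (\<Sum>n. sigma_hull \<mu> (a n)) + ennreal e" .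
qed

end

end

text \<open>If the hull is zero, \<open>a\<close> has covers of mass below
  \<open>(1 / 2) ^ n\<close>. The diagonal property truncates the \<open>n\<close>-th cover to
  finitely many sets so that the uncovered remainders are dominated by a vanishing \<open>d\<close>.
  For all \<open>n \<ge> k\<close> the truncated cover contains \<open>a - d k\<close>, which thus
  has charge 0 and is empty; so \<open>a\<close> lies below every \<open>d k\<close>.\<close>

lemma (in concentrated_algebra) sigma_hull_pos:
  assumes \<mu>: "additive M \<mu>" "\<And>a. 0 \<le> \<mu> a" "\<And>a. a \<in> M \<Longrightarrow> \<mu> a = 0 \<Longrightarrow> a = {}"
    and a: "a \<in> M" "sigma_hull \<mu> a = 0"
  shows "a = {}"
proof -
  have "\<exists>p\<in>covers a. (\<Sum>k. ennreal (\<mu> (p k))) < ennreal ((1 / 2) ^ n)" for n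
  proof -
    have "sigma_hull \<mu> a < ennreal ((1 / 2) ^ n)" using a(2) by simp
    then show ?thesis unfolding sigma_hull_def INF_less_iff .
  qed
  then obtain p where p: "\<And>n. p n \<in> covers a" "\<And>n. (\<Sum>k. ennreal (\<mu> (p n k))) < ennreal ((1 / 2) ^ n)"
    by metis
  note pM = coversD(1)[OF p(1)]
  have small: "\<mu> (\<Union>i<g. p n i) \<le> (1 / 2) ^ n" for g n
  proof -
    have "ennreal (\<mu> (\<Union>i<g. p n i)) \<le> ennreal (\<Sum>i<g. \<mu> (p n i))"
      using pM by (intro ennreal_leI charge_finite_UN[OF \<mu>(1,2)]) auto
    also have "\<dots> = (\<Sum>i<g. ennreal (\<mu> (p n i)))" using \<mu>(2) by (simp add: sum_ennreal)
    also have "\<dots> \<le> (\<Sum>i. ennreal (\<mu> (p n i)))" by (intro sum_le_suminf summableI) auto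
    also have "\<dots> \<le> ennreal ((1 / 2) ^ n)" using p(2) by (rule less_imp_le)
    finally show ?thesis by simp
  qed
  obtain g where g: "null_seq M (\<lambda>n. a - (\<Union>i<g n. p n i))"
  proof (rule diagonal[of "\<lambda>n k. a - (\<Union>i<k. p n i)"])
    show "range (\<lambda>k. a - (\<Union>i<k. p n i)) \<subseteq> M" for n using a(1) pM by auto
    show "decseq (\<lambda>k. a - (\<Union>i<k. p n i))" for n
      by (force simp: decseq_def)
    show "vanishing M (\<lambda>k. a - (\<Union>i<k. p n i))" for n
      unfolding vanishing_def
    proof (intro ballI impI)
      fix b assume b: "b \<in> M" "\<forall>k. b \<subseteq> a - (\<Union>i<k. p n i)"
      have "b \<inter> p n i = {}" for i using b(2)[rule_format, of "Suc i"] by auto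
      moreover have "b \<subseteq> a" using b(2) by blast
      ultimately show "b = {}" by (rule coversD(2)[OF p(1) b(1), rotated])
    qed
  qed
  then obtain d where d: "range d \<subseteq> M" "decseq d" "vanishing M d"
    "\<And>n. a - (\<Union>i<g n. p n i) \<subseteq> d n"
    unfolding null_seq_def by blast
  have dM: "d k \<in> M" for k using d(1) by blast
  have "a \<subseteq> d k" for k
  proof -
    have "\<mu> (a - d k) \<le> (1 / 2) ^ n" if "k \<le> n" for n
    proof -
      have "a - d k \<subseteq> (\<Union>i<g n. p n i)" using decseqD[OF d(2) that] d(4)[of n] by blast
      then have "\<mu> (a - d k) \<le> \<mu> (\<Union>i<g n. p n i)"
        using a(1) dM pM by (intro charge_mono[OF \<mu>(1,2)]) auto
      then show ?thesis using small[of n "g n"] by simp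
    qed
    then have "\<mu> (a - d k) \<le> 0"
      by (intro LIMSEQ_le_const[OF LIMSEQ_power_zero[of "1 / 2 :: real"]]) auto
    then have "\<mu> (a - d k) = 0" using \<mu>(2)[of "a - d k"] by linarith
    then have "a - d k = {}" using a(1) dM by (intro \<mu>(3)) auto
    then show ?thesis by blast
  qed
  then show ?thesis by (intro vanishingD[OF d(3) a(1)])
qed

lemma (in concentrated_algebra) carries_measure:
  assumes ne: "\<Omega> \<noteq> {}"
    and sup: "\<And>A. A \<subseteq> M \<Longrightarrow> countable A \<Longrightarrow> \<exists>s. isLub M A s"
  shows "\<exists>m. measure_on \<Omega> M m"
proof -
  obtain \<mu> :: "'a set \<Rightarrow> real" where \<mu>: "additive M \<mu>" "\<And>a. 0 \<le> \<mu> a"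
    "\<And>a. a \<in> M \<Longrightarrow> \<mu> a = 0 \<Longrightarrow> a = {}"
    using strictly_positive_charge[OF ne] by blast
  define \<nu> where "\<nu> = sigma_hull \<mu>"
  note bound = sigma_hull_le_charge[OF \<mu>(1,2), folded \<nu>_def]
  have fin: "\<nu> a < top" if "a \<in> M" for a
    using bound[OF that] by (rule le_less_trans) simp
  have pos: "0 < \<nu> a" if "a \<in> M" "a \<noteq> {}" for a
    using sigma_hull_pos[OF \<mu> that(1)] that(2) by (auto simp: \<nu>_def zero_less_iff_neq_zero)
  \<comment> \<open>The premises say in order terms that \<open>s\<close> is the supremum of the
    \<open>a n\<close>. One statement thus serves both finite unions, padded with empty sets, and
    suprema in \<open>M\<close>.\<close>
  have sigma: "(\<Sum>n. \<nu> (a n)) = \<nu> s"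
    if "\<And>n. a n \<in> M" "disjoint_family a" "\<And>n. a n \<subseteq> s" "s \<in> M"
      "\<And>b. b \<in> M \<Longrightarrow> b \<subseteq> s \<Longrightarrow> (\<And>n. b \<inter> a n = {}) \<Longrightarrow> b = {}" for a s
    unfolding \<nu>_def
  proof (rule antisym)
    show "(\<Sum>n. sigma_hull \<mu> (a n)) \<le> sigma_hull \<mu> s"
      by (rule sigma_hull_superadditive[OF \<mu>(1,2)]) (fact that)+
    show "sigma_hull \<mu> s \<le> (\<Sum>n. sigma_hull \<mu> (a n))"
      by (rule sigma_hull_subadditive[OF \<mu>(1,2)]) (fact that)+
  qed
  have \<nu>_empty: "\<nu> {} = 0"
    using bound[of "{}"] charge_empty[OF \<mu>(1,2)] by simp
  have add: "\<nu> (a \<union> b) = \<nu> a + \<nu> b" if ab: "a \<in> M" "b \<in> M" "a \<inter> b = {}" for a b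
  proof -
    let ?s = "\<lambda>n::nat. if n = 0 then a else if n = 1 then b else {}"
    have "(\<Sum>n. \<nu> (?s n)) = \<nu> (a \<union> b)"
    proof (rule sigma)
      fix c assume c: "c \<subseteq> a \<union> b" and dj: "\<And>n. c \<inter> ?s n = {}"
      from dj[of 0] dj[of 1] c show "c = {}" by auto
    qed (use ab in \<open>auto simp: disjoint_family_on_def split: if_splits\<close>)
    moreover have "(\<Sum>n. \<nu> (?s n)) = (\<Sum>n\<in>{0, 1}. \<nu> (?s n))"
      by (rule suminf_finite) (auto simp: \<nu>_empty)
    ultimately show ?thesis by simp
  qed
  define c where "c = enn2real (\<nu> \<Omega>)"
  have c: "0 < c" using pos[OF top ne] fin[OF top] by (simp add: c_def enn2real_positive_iff)
  define m where "m a = enn2real (\<nu> a) / c" for a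
  have m_add: "m (a \<union> b) = m a + m b" if "a \<in> M" "b \<in> M" "a \<inter> b = {}" for a b
    using fin that by (simp add: m_def add enn2real_plus add_divide_distrib)
  have "measure_on \<Omega> M m"
    unfolding measure_on_def
  proof (intro conjI ballI impI allI)
    show "m {} = 0" by (simp add: m_def \<nu>_empty)
    show "0 < m a" if "a \<in> M" "a \<noteq> {}" for a
      using pos[OF that] fin[OF that(1)] c by (simp add: m_def enn2real_positive_iff)
    show "m \<Omega> = 1" using c by (simp add: m_def flip: c_def)
    show "m (a \<union> b) = m a + m b" if "a \<in> M" "b \<in> M" "a \<inter> b = {}" for a b
      using m_add that .
    show "m a \<le> m b" if ab: "a \<in> M" "b \<in> M" "a \<subseteq> b" for a b
    proof -
      have "m (a \<union> (b - a)) = m a + m (b - a)" using ab by (intro m_add) auto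
      moreover have "a \<union> (b - a) = b" using ab(3) by auto
      moreover have "0 \<le> m (b - a)" using c by (simp add: m_def)
      ultimately show ?thesis by simp
    qed
    fix a :: "nat \<Rightarrow> 'a set" assume a: "range a \<subseteq> M \<and> disjoint_family a"
    obtain s where s: "isLub M (range a) s" using sup[of "range a"] a by auto
    then have sM: "s \<in> M" "\<And>n. a n \<subseteq> s" by (auto simp: isLub_def leastP_def isUb_def setle_def)
    have "(\<Sum>n. \<nu> (a n)) = \<nu> s"
    proof (rule sigma)
      fix b assume b: "b \<in> M" "b \<subseteq> s" and dj: "\<And>n. b \<inter> a n = {}"
      have "isUb M (range a) (s - b)"
        using sM b(1) dj by (auto simp: isUb_def setle_def)
      then have "s \<subseteq> s - b" using s isLub_le_isUb by blast
      then show "b = {}" using b(2) by blast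
    qed (use a sM in auto)
    then have "(\<lambda>n. \<nu> (a n)) sums \<nu> s" using summable_sums[OF summableI, of "\<lambda>n. \<nu> (a n)"] by simp
    moreover have "\<nu> (a n) = ennreal (enn2real (\<nu> (a n)))" for n
      using fin[of "a n"] a by (simp add: range_subsetD)
    ultimately have "(\<lambda>n. ennreal (enn2real (\<nu> (a n)))) sums ennreal (enn2real (\<nu> s))"
      using fin[OF sM(1)] by simp
    then have "(\<lambda>n. enn2real (\<nu> (a n))) sums enn2real (\<nu> s)"
      by (simp add: sums_ennreal)
    then show "(\<lambda>n. m (a n)) sums m (Sup_in M (range a))"
      unfolding m_def Sup_in_eq[OF s] by (rule sums_divide)
  qed
  show ?thesis by (rule exI[of _ m]) fact
qed

section \<open>The characterization\<close>

lemma isLub_subset_iff: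
  "isLub B A s \<longleftrightarrow> s \<in> B \<and> (\<forall>a\<in>A. a \<subseteq> s) \<and> (\<forall>u\<in>B. (\<forall>a\<in>A. a \<subseteq> u) \<longrightarrow> s \<subseteq> u)"
  by (auto simp: isLub_def leastP_def isUb_def setle_def setge_def)

lemma isGlb_subset_iff:
  "isGlb B A s \<longleftrightarrow> s \<in> B \<and> (\<forall>a\<in>A. s \<subseteq> a) \<and> (\<forall>u\<in>B. (\<forall>a\<in>A. u \<subseteq> a) \<longrightarrow> u \<subseteq> s)"
  by (auto simp: isGlb_def greatestP_def isLb_def setle_def setge_def)

lemma Sup_in_isLub:
  assumes "boolean_sigma_algebra X B" "A \<subseteq> B" "countable A"
  shows "isLub B A (Sup_in B A)"
  using assms unfolding boolean_sigma_algebra_def by (metis Sup_in_eq)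

lemma Inf_in_isGlb:
  assumes "boolean_sigma_algebra X B" "A \<subseteq> B" "countable A"
  shows "isGlb B A (Inf_in B A)"
  using assms unfolding boolean_sigma_algebra_def by (metis Inf_in_eq)

text \<open>The tail suprema are the dominating sequence; their infimum is the limsup.\<close>

lemma null_seq_of_limsup:
  assumes B: "boolean_sigma_algebra X B" and a: "\<And>n. a n \<in> B" and lim: "limsup_in B a = {}"
  shows "null_seq B a"
proof -
  interpret algebra X B
    using B by (simp add: boolean_sigma_algebra_def boolean_algebra_on_def)
  define S where "S n = Sup_in B (a ` {n..})" for n
  have S: "isLub B (a ` {n..}) (S n)" for n
    unfolding S_def using a by (intro Sup_in_isLub[OF B]) auto
  have SB: "S n \<in> B" for n using S[of n] by (simp add: isLub_subset_iff)
  have aS: "a k \<subseteq> S n" if "n \<le> k" for n k using S[of n] that by (simp add: isLub_subset_iff)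
  have Sle: "S n \<subseteq> u" if "u \<in> B" "\<And>k. n \<le> k \<Longrightarrow> a k \<subseteq> u" for n u
    using S[of n] that by (auto simp: isLub_subset_iff)
  have "isGlb B (S ` {1..}) (limsup_in B a)"
    unfolding limsup_in_def S_def[symmetric] using SB by (intro Inf_in_isGlb[OF B]) auto
  then have glb: "b \<subseteq> {}" if "b \<in> B" "\<And>n. 1 \<le> n \<Longrightarrow> b \<subseteq> S n" for b
    using that by (auto simp: isGlb_subset_iff lim)
  show ?thesis
  proof (rule null_seqI)
    show "range a \<subseteq> B" "range S \<subseteq> B" using a SB by auto
    show "decseq S" using aS SB unfolding decseq_def by (intro allI impI Sle) auto
    show "a n \<subseteq> S n" for n by (rule aS) simp
    show "vanishing B S" unfolding vanishing_def using glb by auto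
  qed
qed

lemma concentrated_algebraI:
  assumes B: "boolean_sigma_algebra X B" and wd: "weakly_distributive B"
    and uc: "uniformly_concentrated B"
  shows "\<exists>U. concentrated_algebra X B U"
proof -
  interpret algebra X B
    using B by (simp add: boolean_sigma_algebra_def boolean_algebra_on_def)
  obtain F where F: "\<And>A. antichain_in B A \<Longrightarrow> finite A \<Longrightarrow> A \<noteq> {} \<Longrightarrow> F A \<in> A"
    and lim: "\<And>A. (\<forall>n\<ge>1. antichain_in B (A n) \<and> finite (A n) \<and> card (A n) \<ge> 2 ^ n) \<Longrightarrow>
      lim_in B (\<lambda>n. F (A n)) {}"
    using uc unfolding uniformly_concentrated_def by blast
  define big where "big n A \<longleftrightarrow> antichain_in B A \<and> finite A \<and> 2 ^ n \<le> card A" for n :: nat and A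
  define U where "U n = {b \<in> B. b = {} \<or> (\<exists>A. big n A \<and> b \<subseteq> F A)}" for n
  have bigF: "F A \<in> A" "F A \<in> B" if "big n A" for n A
  proof -
    have "A \<noteq> {}" using that by (auto simp: big_def)
    then show "F A \<in> A" using that F by (simp add: big_def)
    then show "F A \<in> B" using that by (auto simp: big_def antichain_in_def)
  qed
  have null: "null_seq B s" if s: "\<And>n. s n \<in> U n" for s
  \<comment> \<open>If antichains of size \<open>2 ^ N\<close> do not exist, there is no sequence to
    which concentration applies. But then \<open>U n\<close> contains only the empty set from
    \<open>N\<close> on, and \<open>s\<close> is eventually empty.\<close>
  proof (cases "\<forall>n. \<exists>A. big n A")
    case True
    have "\<exists>A. big n A \<and> s n \<subseteq> F A" for n
      using s[of n] True by (auto simp: U_def)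
    then obtain A where A: "\<And>n. big n (A n)" "\<And>n. s n \<subseteq> F (A n)" by metis
    have "lim_in B (\<lambda>n. F (A n)) {}" using A(1) by (intro lim) (auto simp: big_def)
    then have "null_seq B (\<lambda>n. F (A n))"
      using bigF(2)[OF A(1)] by (intro null_seq_of_limsup[OF B]) (simp_all add: lim_in_def)
    then show ?thesis
      by (rule null_seq_mono) (use s A(2) in \<open>auto simp: U_def\<close>)
  next
    case False
    then obtain N where N: "\<And>A. \<not> big N A" by blast
    have empty: "s n = {}" if "N \<le> n" for n
    proof -
      have "\<not> big n A" for A
      proof -
        have "(2 :: nat) ^ N \<le> 2 ^ n" using that by (intro power_increasing) auto
        then show ?thesis using N[of A] unfolding big_def by linarith
      qed
      then show ?thesis using s[of n] by (simp add: U_def)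
    qed
    have sB: "s n \<in> B" for n using s[of n] by (simp add: U_def)
    show ?thesis
    proof (rule null_seqI)
      show "range s \<subseteq> B" using sB by auto
      show "range (\<lambda>n. if n < N then X else {}) \<subseteq> B" by auto
      show "decseq (\<lambda>n. if n < N then X else {})" by (auto simp: decseq_def)
      show "vanishing B (\<lambda>n. if n < N then X else {})" by (auto simp: vanishing_def)
      show "s n \<subseteq> (if n < N then X else {})" for n
        using empty[of n] sB[of n] sets_into_space by auto
    qed
  qed
  have "concentrated_algebra X B U"
  proof unfold_locales
    show "U n \<subseteq> B" "{} \<in> U n" for n by (auto simp: U_def)
    show "b \<in> U n" if "a \<in> U n" "b \<in> B" "b \<subseteq> a" for a b n
      using that unfolding U_def by blast
    show "null_seq B s" if "\<And>n. s n \<in> U n" for s using that by (rule null)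
    show "A \<inter> U n \<noteq> {}" if "antichain_in B A" "finite A" "2 ^ n \<le> card A" for A n
    proof -
      have "big n A" using that by (simp add: big_def)
      then have "F A \<in> A" "F A \<in> U n" using bigF[of n A] unfolding U_def by blast+
      then show ?thesis by blast
    qed
    show "weakly_distributive B" by (rule wd)
  qed
  then show ?thesis by blast
qed

section \<open>A measure forces weak distributivity and uniform concentration\<close>

lemma half_geometric_le: "(\<Sum>i<n. (1 / 2 :: real) ^ (i + k)) \<le> 2 * (1 / 2) ^ k"
proof -
  have "(\<Sum>i<n. (1 / 2 :: real) ^ (i + k)) = 2 * (1 / 2) ^ k - 2 * (1 / 2) ^ (n + k)"
  proof (induction n)
    case (Suc n)
    have "(1 / 2 :: real) ^ (Suc n + k) = 1 / 2 * (1 / 2) ^ (n + k)" by simp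
    then show ?case using Suc by (simp only: sum.lessThan_Suc)
  qed simp
  then show ?thesis by simp
qed

locale boolean_measure_space = algebra \<Omega> M for \<Omega> :: "'a set" and M +
  fixes m :: "'a set \<Rightarrow> real"
  assumes sigma: "boolean_sigma_algebra \<Omega> M" and measure: "measure_on \<Omega> M m"
begin

lemma
  shows m_empty: "m {} = 0"
    and m_pos: "a \<in> M \<Longrightarrow> a \<noteq> {} \<Longrightarrow> 0 < m a"
    and m_space: "m \<Omega> = 1"
    and m_mono: "a \<in> M \<Longrightarrow> b \<in> M \<Longrightarrow> a \<subseteq> b \<Longrightarrow> m a \<le> m b"
    and m_additive: "additive M m"
    and m_sums: "range s \<subseteq> M \<Longrightarrow> disjoint_family s \<Longrightarrow> (\<lambda>n. m (s n)) sums m (Sup_in M (range s))"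
  using measure by (simp_all add: measure_on_def additive_def)

lemma m_nonneg: "a \<in> M \<Longrightarrow> 0 \<le> m a"
  using m_mono[of "{}" a] m_empty by auto

lemma m_le_1: "a \<in> M \<Longrightarrow> m a \<le> 1"
  using m_mono[of a \<Omega>] m_space sets_into_space by auto

lemma space_nonempty: "\<Omega> \<noteq> {}"
  using m_empty m_space by auto

lemma Diff_m: "a \<in> M \<Longrightarrow> b \<in> M \<Longrightarrow> b \<subseteq> a \<Longrightarrow> m (a - b) = m a - m b"
  using additiveD[OF m_additive, of b "a - b"] by (simp add: Diff Un_absorb1)

lemma m_eq_empty:
  assumes "a \<in> M" "\<And>n::nat. n0 \<le> n \<Longrightarrow> m a \<le> C * (1 / 2) ^ n"
  shows "a = {}"
proof (rule ccontr)
  assume "a \<noteq> {}"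
  have "(\<lambda>n. C * (1 / 2 :: real) ^ n) \<longlonglongrightarrow> C * 0"
    by (intro tendsto_mult tendsto_const LIMSEQ_power_zero) simp
  then have "m a \<le> C * 0"
    by (rule LIMSEQ_le_const) (use assms(2) in blast)
  then show False using m_pos[OF assms(1) \<open>a \<noteq> {}\<close>] by simp
qed

text \<open>Because \<open>d\<close> vanishes, the supremum in \<open>M\<close> of its layers is all
  of \<open>d 0\<close>, although their union may be smaller. Countable additivity then
  telescopes.\<close>

lemma m_vanishing:
  assumes d: "range d \<subseteq> M" "decseq d" "vanishing M d"
  shows "(\<lambda>n. m (d n)) \<longlonglongrightarrow> 0"
proof -
  define s where "s n = d n - d (Suc n)" for n
  have dM: "d n \<in> M" for n using d(1) by blast
  then have sM: "range s \<subseteq> M" by (auto simp: s_def)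
  have disj: "disjoint_family s"
    unfolding disjoint_family_on_def
  proof (intro ballI impI)
    fix k l :: nat
    have step: "s k \<inter> s l = {}" if "k < l" for k l
      using decseqD[OF d(2), of "Suc k" l] that by (auto simp: s_def)
    assume "k \<noteq> l"
    then show "s k \<inter> s l = {}" using step by (metis linorder_neqE_nat Int_commute)
  qed
  have "isLub M (range s) (d 0)"
    unfolding isLub_subset_iff
  proof (intro conjI ballI impI dM)
    show "a \<subseteq> d 0" if "a \<in> range s" for a
      using that decseqD[OF d(2), of 0] by (auto simp: s_def)
    fix u assume u: "u \<in> M" "\<forall>a\<in>range s. a \<subseteq> u"
    have "d 0 - u \<subseteq> d n" for n
    proof (induction n)
      case (Suc n)
      have "s n \<subseteq> u" using u(2) by blast
      then show ?case using Suc by (auto simp: s_def)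
    qed blast
    then have "d 0 - u = {}" using u(1) dM by (intro vanishingD[OF d(3)]) auto
    then show "d 0 \<subseteq> u" by blast
  qed
  then have "(\<lambda>n. m (s n)) sums m (d 0)"
    using m_sums[OF sM disj] by (simp add: Sup_in_eq)
  moreover have "m (s n) = m (d n) - m (d (Suc n))" for n
    unfolding s_def using decseqD[OF d(2), of n "Suc n"] by (intro Diff_m dM) auto
  ultimately have "(\<lambda>n. m (d 0) - m (d n)) \<longlonglongrightarrow> m (d 0)"
    by (simp add: sums_def sum_lessThan_telescope'[of "\<lambda>n. m (d n)"])
  then have "(\<lambda>n. m (d 0) - (m (d 0) - m (d n))) \<longlonglongrightarrow> m (d 0) - m (d 0)"
    by (intro tendsto_diff tendsto_const)
  then show ?thesis by simp
qed

text \<open>Countable subadditivity for suprema in \<open>M\<close>: what \<open>s\<close> has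
  beyond the finite unions vanishes, so its measure tends to 0.\<close>

lemma m_Sup_le:
  assumes s: "isLub M (range a) s" and a: "\<And>n::nat. a n \<in> M" and K: "\<And>n. (\<Sum>i<n. m (a i)) \<le> K"
  shows "m s \<le> K"
proof -
  define d where "d n = s - (\<Union>i<n. a i)" for n
  have sM: "s \<in> M" and as: "\<And>n. a n \<subseteq> s"
    and least: "\<And>u. u \<in> M \<Longrightarrow> (\<And>n. a n \<subseteq> u) \<Longrightarrow> s \<subseteq> u"
    using s by (auto simp: isLub_subset_iff)
  have "(\<lambda>n. m (d n)) \<longlonglongrightarrow> 0"
  proof (rule m_vanishing)
    show "range d \<subseteq> M" using sM a by (auto simp: d_def)
    show "decseq d" by (force simp: decseq_def d_def)
    show "vanishing M d"
      unfolding vanishing_def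
    proof (intro ballI impI)
      fix b assume b: "b \<in> M" "\<forall>n. b \<subseteq> d n"
      have "s \<subseteq> s - b"
      proof (rule least)
        fix n
        have "b \<subseteq> d (Suc n)" using b(2) by blast
        then show "a n \<subseteq> s - b" using as[of n] by (auto simp: d_def)
      qed (use sM b(1) in auto)
      moreover have "b \<subseteq> s" using b(2)[rule_format, of 0] by (simp add: d_def)
      ultimately show "b = {}" by blast
    qed
  qed
  moreover have "m s - K \<le> m (d n)" for n
  proof -
    have U: "(\<Union>i<n. a i) \<in> M" "(\<Union>i<n. a i) \<subseteq> s" using a as by auto
    have "m (d n) = m s - m (\<Union>i<n. a i)" unfolding d_def by (rule Diff_m[OF sM U])
    moreover have "m (\<Union>i<n. a i) \<le> (\<Sum>i<n. m (a i))"
      by (rule charge_finite_UN[OF m_additive m_nonneg]) (use a in auto)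
    ultimately show ?thesis using K[of n] by linarith
  qed
  ultimately have "m s - K \<le> 0" by (intro LIMSEQ_le_const) auto
  then show ?thesis by simp
qed

lemma m_Sup_geometric_le:
  assumes "isLub M (range a) s" "\<And>n::nat. a n \<in> M" "\<And>n. m (a n) \<le> (1 / 2) ^ (n + k)"
  shows "m s \<le> 2 * (1 / 2) ^ k"
proof (rule m_Sup_le[OF assms(1,2)])
  show "(\<Sum>i<n. m (a i)) \<le> 2 * (1 / 2) ^ k" for n
    using sum_mono[of "{..<n}" "\<lambda>i. m (a i)" "\<lambda>i. (1 / 2) ^ (i + k)"] assms(3)
      half_geometric_le[where n = n and k = k] by simp
qed

lemma antichain_sum_le:
  assumes "antichain_in M A" "finite A"
  shows "(\<Sum>a\<in>A. m a) \<le> 1"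
proof -
  have A: "\<And>a. a \<in> A \<Longrightarrow> a \<in> M" "disjoint_family_on (\<lambda>a. a) A"
    using antichain_inD[OF assms(1)] by (auto simp: disjoint_family_on_def)
  then have "(\<Sum>a\<in>A. m a) = m (\<Union>a\<in>A. a)"
    by (intro charge_disjoint_sum[symmetric] m_additive m_nonneg assms(2))
  also have "\<dots> \<le> 1" using A(1) assms(2) by (intro m_le_1) auto
  finally show ?thesis .
qed

lemma countable_antichain:
  assumes A: "antichain_in M A"
  shows "countable A"
proof -
  have "A \<subseteq> (\<Union>k. {a \<in> A. inverse (real (Suc k)) < m a})"
  proof
    fix a assume "a \<in> A"
    then have "0 < m a" using antichain_inD[OF A] m_pos by blast
    then obtain k where "inverse (real (Suc k)) < m a" using reals_Archimedean by blast
    with \<open>a \<in> A\<close> show "a \<in> (\<Union>k. {a \<in> A. inverse (real (Suc k)) < m a})" by blast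
  qed
  moreover have "finite {a \<in> A. inverse (real (Suc k)) < m a}" for k
  proof (rule ccontr)
    assume "infinite {a \<in> A. inverse (real (Suc k)) < m a}"
    then obtain S where S: "finite S" "card S = Suc (Suc k)" "S \<subseteq> {a \<in> A. inverse (real (Suc k)) < m a}"
      using infinite_arbitrarily_large by blast
    then have "antichain_in M S" using A by (blast intro: antichain_in_subset)
    then have "(\<Sum>a\<in>S. m a) \<le> 1" using S(1) by (rule antichain_sum_le)
    moreover have "real (card S) * inverse (real (Suc k)) \<le> (\<Sum>a\<in>S. m a)"
      using S(3) by (intro sum_bounded_below) auto
    ultimately have "real (Suc (Suc k)) * inverse (real (Suc k)) \<le> 1" unfolding S(2) by linarith
    then show False by (simp add: field_simps)
  qed
  then have "countable (\<Union>k. {a \<in> A. inverse (real (Suc k)) < m a})"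
    by (intro countable_UN) (auto intro: countable_finite)
  ultimately show ?thesis by (rule countable_subset)
qed

text \<open>The least of at least \<open>2 ^ n\<close> disjoint elements has measure at most
  \<open>(1 / 2) ^ n\<close>, so the tail suprema have measure at most
  \<open>2 * (1 / 2) ^ n\<close>.\<close>

lemma uniformly_concentrated: "uniformly_concentrated M"
  unfolding uniformly_concentrated_def
proof (intro exI conjI allI impI)
  define F where "F = arg_min_on m"
  have F: "F A \<in> A" "m (F A) \<le> m a" if "finite A" "a \<in> A" for A a
    using arg_min_if_finite[of A m] that unfolding F_def by fastforce+
  show "F A \<in> A" if "antichain_in M A \<and> finite A \<and> A \<noteq> {}" for A using F(1) that by blast
  fix A :: "nat \<Rightarrow> 'a set set"
  assume A: "\<forall>n\<ge>1. antichain_in M (A n) \<and> finite (A n) \<and> 2 ^ n \<le> card (A n)"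
  define a where "a n = F (A n)" for n
  \<comment> \<open>Nothing is known about \<open>A 0\<close>, so \<open>a 0\<close> may lie outside
    \<open>M\<close> and all tails start at 1 or later.\<close>
  have aM: "a n \<in> M" and am: "m (a n) \<le> (1 / 2) ^ n" if "1 \<le> n" for n
  proof -
    have An: "antichain_in M (A n)" "finite (A n)" "2 ^ n \<le> card (A n)" using A that by auto
    then have "A n \<noteq> {}" by auto
    then show "a n \<in> M" using F(1)[of "A n"] An antichain_inD(1) unfolding a_def by blast
    have "2 ^ n * m (a n) \<le> real (card (A n)) * m (a n)"
      using An(3) m_nonneg[OF \<open>a n \<in> M\<close>] by (intro mult_right_mono) (simp_all flip: of_nat_le_iff)
    also have "\<dots> \<le> (\<Sum>b\<in>A n. m b)"
      using F(2)[OF An(2)] unfolding a_def by (intro sum_bounded_below)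
    also have "\<dots> \<le> 1" by (rule antichain_sum_le[OF An(1,2)])
    finally show "m (a n) \<le> (1 / 2) ^ n" by (simp add: power_one_over field_simps)
  qed
  define S where "S n = Sup_in M (a ` {n..})" for n
  have S: "isLub M (a ` {n..}) (S n)" if "1 \<le> n" for n
    unfolding S_def using aM that by (intro Sup_in_isLub[OF sigma]) auto
  then have SM: "S n \<in> M" if "1 \<le> n" for n using that by (simp add: isLub_subset_iff)
  have Sm: "m (S n) \<le> 2 * (1 / 2) ^ n" if "1 \<le> n" for n
  proof (rule m_Sup_geometric_le)
    have "a ` {n..} = range (\<lambda>i. a (i + n))"
      by (auto simp: image_iff) (metis le_add_diff_inverse2)
    then show "isLub M (range (\<lambda>i. a (i + n))) (S n)" using S[OF that] by simp
  qed (use aM am that in auto)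
  have "limsup_in M a = {}"
  proof (rule m_eq_empty)
    have "isGlb M (S ` {1..}) (limsup_in M a)"
      unfolding limsup_in_def S_def[symmetric] using SM by (intro Inf_in_isGlb[OF sigma]) auto
    then have glb: "limsup_in M a \<in> M" "\<And>n. 1 \<le> n \<Longrightarrow> limsup_in M a \<subseteq> S n"
      by (auto simp: isGlb_subset_iff)
    show "limsup_in M a \<in> M" by (rule glb)
    show "m (limsup_in M a) \<le> 2 * (1 / 2) ^ n" if "1 \<le> n" for n
      using m_mono[OF glb(1) SM[OF that] glb(2)[OF that]] Sm[OF that] by simp
  qed
  moreover have "liminf_in M a = {}"
  proof -
    have "Inf_in M (a ` {n..}) = {}" if "1 \<le> n" for n
    proof (rule m_eq_empty)
      have "isGlb M (a ` {n..}) (Inf_in M (a ` {n..}))"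
        using aM that by (intro Inf_in_isGlb[OF sigma]) auto
      then have glb: "Inf_in M (a ` {n..}) \<in> M" "\<And>k. n \<le> k \<Longrightarrow> Inf_in M (a ` {n..}) \<subseteq> a k"
        by (auto simp: isGlb_subset_iff)
      show "Inf_in M (a ` {n..}) \<in> M" by (rule glb)
      show "m (Inf_in M (a ` {n..})) \<le> 1 * (1 / 2) ^ k" if k: "n \<le> k" for k
        using m_mono[OF glb(1) aM glb(2)[OF k]] am[of k] \<open>1 \<le> n\<close> k by simp
    qed
    then have "(\<lambda>n. Inf_in M (a ` {n..})) ` {1..} = {{}}" by auto
    then show ?thesis
      unfolding liminf_in_def by (auto intro!: Sup_in_eq simp: isLub_subset_iff)
  qed
  ultimately show "lim_in M (\<lambda>n. F (A n)) {}" unfolding lim_in_def a_def by simp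
qed

text \<open>For each \<open>p\<close>, keep the first \<open>k n p\<close> elements of every
  \<open>W n\<close>, leaving a remainder of measure below \<open>(1 / 2) ^ (n + p)\<close>. The
  supremum \<open>B p\<close> of the remainders is small, and below its complement
  \<open>Z p\<close> only the kept elements are met. Making the \<open>Z p\<close> disjoint gives
  the partition: an element missing all of it lies below every \<open>B p\<close>, so has measure
  0.\<close>

lemma weakly_distributive: "weakly_distributive M"
  unfolding weakly_distributive_def
proof (intro allI impI)
  fix W :: "nat \<Rightarrow> 'a set set"
  assume W: "\<forall>n. partition_in M (W n)"
  then have Wac: "antichain_in M (W n)" for n by (simp add: partition_in_def)
  have Wne: "W n \<noteq> {}" for n
    using partition_meets[OF W[rule_format, of n] top] space_nonempty by blast
  \<comment> \<open>The enumeration repeats elements when \<open>W n\<close> is finite, which is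
    harmless: it only has to exhaust \<open>W n\<close>.\<close>
  define w where "w n = from_nat_into (W n)" for n
  have wW: "w n i \<in> W n" for n i unfolding w_def using Wne by (rule from_nat_into)
  have surj: "\<exists>i. w n i = b" if "b \<in> W n" for n b
    unfolding w_def using from_nat_into_surj[OF countable_antichain[OF Wac] that] .
  have wM: "w n i \<in> M" for n i using antichain_inD(1)[OF Wac wW] .
  define c where "c n k = \<Omega> - (\<Union>i<k. w n i)" for n k
  have cM: "c n k \<in> M" for n k using wM by (auto simp: c_def)
  have small: "\<exists>k. m (c n k) < e" if "0 < e" for n and e :: real
  proof -
    have "(\<lambda>k. m (c n k)) \<longlonglongrightarrow> 0"
    proof (rule m_vanishing)
      show "range (c n) \<subseteq> M" using cM by auto
      show "decseq (c n)" by (force simp: decseq_def c_def)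
      show "vanishing M (c n)"
        unfolding vanishing_def
      proof (intro ballI impI)
        fix b assume b: "b \<in> M" "\<forall>k. b \<subseteq> c n k"
        show "b = {}"
        proof (rule partition_meets[OF W[rule_format] b(1)])
          fix v assume "v \<in> W n"
          then obtain i where "v = w n i" using surj by blast
          then show "b \<inter> v = {}" using b(2)[rule_format, of "Suc i"] by (auto simp: c_def)
        qed
      qed
    qed
    then have "eventually (\<lambda>k. m (c n k) < e) sequentially" using that by (rule order_tendstoD(2))
    then show ?thesis by (auto simp: eventually_sequentially)
  qed
  have "\<exists>k. m (c n k) < (1 / 2) ^ (n + p)" for n p by (rule small) simp
  then obtain k where k: "\<And>n p. m (c n (k n p)) < (1 / 2) ^ (n + p)" by metis
  define B where "B p = Sup_in M (range (\<lambda>n. c n (k n p)))" for p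
  have B: "isLub M (range (\<lambda>n. c n (k n p))) (B p)" for p
    unfolding B_def using cM by (intro Sup_in_isLub[OF sigma]) auto
  then have BM: "B p \<in> M" and cB: "c n (k n p) \<subseteq> B p" for n p by (auto simp: isLub_subset_iff)
  have Bm: "m (B p) \<le> 2 * (1 / 2) ^ p" for p
    by (rule m_Sup_geometric_le[OF B]) (use cM k in \<open>auto intro: less_imp_le\<close>)
  define Z where "Z p = \<Omega> - B p" for p
  define V where "V = range (disjointed Z) - {{}}"
  have ZM: "range Z \<subseteq> M" using BM by (auto simp: Z_def)
  have "partition_in M V"
  proof (rule partition_inI)
    show "antichain_in M V"
      unfolding antichain_in_def
    proof (intro conjI ballI impI)
      show "V \<subseteq> M - {{}}" using range_disjointed_sets[OF ZM] by (auto simp: V_def)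
      fix u v assume "u \<in> V" "v \<in> V" "u \<noteq> v"
      then obtain i j where "u = disjointed Z i" "v = disjointed Z j" "i \<noteq> j" by (auto simp: V_def)
      then show "u \<inter> v = {}"
        using disjoint_family_disjointed[of Z] by (simp add: disjoint_family_on_def)
    qed
    fix b assume b: "b \<in> M" and dj: "\<And>v. v \<in> V \<Longrightarrow> b \<inter> v = {}"
    have "b \<inter> disjointed Z p = {}" for p
      using dj[of "disjointed Z p"] by (cases "disjointed Z p = {}") (auto simp: V_def)
    then have "b \<inter> (\<Union>p. disjointed Z p) = {}" by blast
    then have "b \<inter> (\<Union>p. Z p) = {}" by (simp add: UN_disjointed_eq)
    then have "b \<subseteq> B p" for p using sets_into_space[OF b] by (auto simp: Z_def)
    then have "m b \<le> 2 * (1 / 2) ^ p" for p using m_mono[OF b BM, of p] Bm[of p] by fastforce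
    with b show "b = {}" by (rule m_eq_empty)
  qed
  moreover have "finite {b \<in> W n. a \<inter> b \<noteq> {}}" if a: "a \<in> V" for a n
  proof -
    obtain p where p: "a \<subseteq> Z p" using a disjointed_subset[of Z] by (auto simp: V_def)
    have "{b \<in> W n. a \<inter> b \<noteq> {}} \<subseteq> w n ` {..<k n p}"
    proof
      fix b assume "b \<in> {b \<in> W n. a \<inter> b \<noteq> {}}"
      then obtain x where x: "b \<in> W n" "x \<in> a" "x \<in> b" by blast
      then have "x \<in> \<Omega>" "x \<notin> c n (k n p)" using p cB[of n p] by (auto simp: Z_def)
      then obtain i where i: "i < k n p" "x \<in> w n i" by (auto simp: c_def)
      have "b = w n i"
      proof (rule ccontr)
        assume "b \<noteq> w n i"
        then have "b \<inter> w n i = {}" by (rule antichain_inD(3)[OF Wac x(1) wW])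
        then show False using x(3) i(2) by blast
      qed
      with i(1) show "b \<in> w n ` {..<k n p}" by blast
    qed
    then show ?thesis by (rule finite_subset) simp
  qed
  ultimately show "\<exists>V. partition_in M V \<and> (\<forall>a\<in>V. \<forall>n. finite {b \<in> W n. a \<inter> b \<noteq> {}})" by blast
qed

end

theorem theorem1p8:
  fixes X :: "'a set" and B :: "'a set set"
  assumes "boolean_sigma_algebra X B"
  shows "measure_algebra X B \<longleftrightarrow> weakly_distributive B \<and> uniformly_concentrated B"
proof
  assume "measure_algebra X B"
  then obtain m where m: "measure_on X B m" by (auto simp: measure_algebra_def)
  have "algebra X B" using assms by (simp add: boolean_sigma_algebra_def boolean_algebra_on_def)
  then interpret boolean_measure_space X B m
    using assms m by (intro boolean_measure_space.intro boolean_measure_space_axioms.intro)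
  show "weakly_distributive B \<and> uniformly_concentrated B"
    using weakly_distributive uniformly_concentrated ..
next
  assume "weakly_distributive B \<and> uniformly_concentrated B"
  then obtain U where U: "concentrated_algebra X B U"
    using concentrated_algebraI[OF assms] by blast
  have "\<exists>m. measure_on X B m"
  proof (rule concentrated_algebra.carries_measure[OF U])
    show "X \<noteq> {}" using assms by (simp add: boolean_sigma_algebra_def boolean_algebra_on_def)
    show "\<exists>s. isLub B A s" if "A \<subseteq> B" "countable A" for A
      using assms that by (simp add: boolean_sigma_algebra_def)
  qed
  then show "measure_algebra X B" using assms by (simp add: measure_algebra_def)
qed

end
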